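(* Let $H$ and $U$ be real Hilbert spaces, let $A:D(A)\subset H\to H$ be a densely defined linear operator generating a strongly continuous semigroup of contractions on $H$, let $B\in\mathcal L(U,H)$ with adjoint $B^\star$, and let $k>0$. Assume that the origin of the linear system $\frac{d}{dt}z=(A-kBB^\star)z$ is globally exponentially stable, i.e. there exist $C,\alpha>0$ such that $\|e^{t(A-kBB^\star)}z_0\|_H\le Ce^{-\alpha t}\|z_0\|_H$ for all $z_0\in H$ and $t\ge 0$. Let $S$ be a real Banach space such that $(U,S)$ is a rigged Hilbert space, and let $\sigma:U\to S$ be a function satisfying properties (D1) and (D3) given in the context. Consider the nonlinear system $$\frac{d}{dt}z=A_\sigma(z):=Az-\sqrt{k}\,B\sigma(\sqrt{k}\,B^\star z),\qquad z(0)=z_0,\qquad D(A_\sigma)=D(A).\tag{$*$}$$ 1. If $S=U$, there exists a strict and global Lyapunov function for $( * )$. 2. If $S\neq U$, assume moreover that $\sigma$ satisfies property (D2) given in the context and that there exists a positive constant $c_S$ such that $$\|B^\star s\|_S\le c_S\|s\|_{D(A)},\qquad\forall s\in D(A)$$ (in particular $B^\star s\in S$ for $s\in D(A)$). Then the origin of $( * )$ is semi-globally exponentially stable in $D(A)$: for every $r>0$ there exist positive constants $\mu=\mu(r)$ and $K=K(r)$ such that, for every $z_0\in D(A)$ with $\|z_0\|_{D(A)}\le r$, $$\|W_\sigma(t)z_0\|_H\le Ke^{-\mu t}\|z_0\|_H,\qquad\forall t\ge 0.$$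
   Context: $\|z\|_{D(A)}=\|z\|_H+\|Az\|_H$ is the graph norm. Rigged Hilbert space: $S$ is a dense, continuously embedded subspace of $U$, so that (identifying $U$ with its dual) $S\subseteq U\subseteq S'$, and the duality pairing is compatible with the inner product of $U$: $(u,v)_{S\times S'}=\langle u,v\rangle_U$ for all $u\in S$, $v\in U$. $\|\cdot\|_{S'}$ is the dual norm. When $S=U$, all these norms coincide with $\|\cdot\|_U$. Properties of $\sigma:U\to S$: (D1) $\sigma$ is locally Lipschitz (as a map from $U$ to $U$). (D2) $\langle\sigma(s_1)-\sigma(s_2),s_1-s_2\rangle_U\ge 0$ for all $s_1,s_2\in U$. (D3) There exist positive constants $C_1,C_2$ and a continuous non-decreasing function $h:\mathbb R\to\mathbb R_+$ with $h(0)>0$ such that $$\|\sigma(s)-C_1s\|_{S'}\le C_2\,h(\|s\|_S)\,\langle\sigma(s),s\rangle_U\qquad\forall s\in S.$$ A strong solution of $( * )$ is a locally absolutely continuous function $z:[0,\infty)\to H$ with $z(0)=z_0$, $z(t)\in D(A)$ for all $t\geq 0$, satisfying $( * )$ for almost every $t\ge0$. Under (D1), (D2), (D3) it is known that for every $z_0\in D(A)$ there is a unique strong solution, denoted $W_\sigma(t)z_0$, and that $t\mapsto\|W_\sigma(t)z_0\|_H$ and $t\mapsto\|A_\sigma W_\sigma(t)z_0\|_H$ are nonincreasing. A strict and global Lyapunov function for $( * )$ is a continuous function $\tilde V:H\to\mathbb R_+$, independent of the initial condition, which is positive definite and coercive ($\tilde V(0)=0$ and $\tilde V(z)\ge a\|z\|_H^2$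 for all $z\in H$, for some $a>0$), and for which there is a constant $c>0$, independent of the initial condition, such that along every strong solution $z(\cdot)$ of $( * )$ one has $\frac{d}{dt}\tilde V(z(t))\le -c\|z(t)\|_H^2$ for almost every $t\geq 0$. *)

theory Defs
  imports "HOL-Analysis.Analysis"
begin

text \<open>Real Hilbert spaces are types of class \<open>{real_inner, complete_space}\<close>. An unbounded operator is
  a pair of its domain \<open>D\<close> and a total function whose values outside \<open>D\<close> are irrelevant.\<close>

definition densely_defined_linear ::
    "'h::real_normed_vector set \<Rightarrow> ('h \<Rightarrow> 'h) \<Rightarrow> bool" where
  "densely_defined_linear D A \<longleftrightarrow>
     subspace D \<and> closure D = UNIV \<and>
     (\<forall>x\<in>D. \<forall>y\<in>D. A (x + y) = A x + A y) \<and> (\<forall>c. \<forall>x\<in>D. A (c *\<^sub>R x) = c *\<^sub>R A x)"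

definition graph_norm :: "('h::real_normed_vector \<Rightarrow> 'h) \<Rightarrow> 'h \<Rightarrow> real" where
  "graph_norm A x = norm x + norm (A x)"

definition C0_semigroup :: "(real \<Rightarrow> 'h::real_normed_vector \<Rightarrow> 'h) \<Rightarrow> bool" where
  "C0_semigroup T \<longleftrightarrow>
     (\<forall>t\<ge>0. bounded_linear (T t)) \<and> (\<forall>x. T 0 x = x) \<and>
     (\<forall>s\<ge>0. \<forall>t\<ge>0. \<forall>x. T (s + t) x = T s (T t x)) \<and>
     (\<forall>x. ((\<lambda>t. T t x) \<longlongrightarrow> x) (at_right 0))"

text \<open>The domain is part of the condition: \<open>D\<close> is exactly the set of points at which the difference
  quotient converges.\<close>

definition generates ::
    "'h::real_normed_vector set \<Rightarrow> ('h \<Rightarrow> 'h) \<Rightarrow> (real \<Rightarrow> 'h \<Rightarrow> 'h) \<Rightarrow> bool" where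
  "generates D A T \<longleftrightarrow>
     C0_semigroup T \<and>
     (\<forall>x y. (x \<in> D \<and> y = A x) \<longleftrightarrow> ((\<lambda>t. (T t x - x) /\<^sub>R t) \<longlongrightarrow> y) (at_right 0))"

definition generates_contractions :: "'h::real_normed_vector set \<Rightarrow> ('h \<Rightarrow> 'h) \<Rightarrow> bool" where
  "generates_contractions D A \<longleftrightarrow>
     (\<exists>T. generates D A T \<and> (\<forall>t\<ge>0. \<forall>x. norm (T t x) \<le> norm x))"

definition generates_exp_stable :: "'h::real_normed_vector set \<Rightarrow> ('h \<Rightarrow> 'h) \<Rightarrow> bool" where
  "generates_exp_stable D A \<longleftrightarrow>
     (\<exists>T. generates D A T \<and>
        (\<exists>C>0. \<exists>\<alpha>>0. \<forall>x. \<forall>t\<ge>0. norm (T t x) \<le> C * exp (- \<alpha> * t) * norm x))"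

text \<open>The Banach space \<open>S\<close> is a type of class \<open>banach\<close>, together with its inclusion map \<open>J\<close> into \<open>U\<close>.\<close>

definition rigged_hilbert :: "('s::banach \<Rightarrow> 'u::{real_inner,complete_space}) \<Rightarrow> bool" where
  "rigged_hilbert J \<longleftrightarrow> bounded_linear J \<and> inj J \<and> closure (range J) = UNIV"

text \<open>\<open>S = U\<close> as normed spaces: the inclusion is onto and the norms coincide.\<close>

definition trivial_rigging :: "('s::banach \<Rightarrow> 'u::{real_inner,complete_space}) \<Rightarrow> bool" where
  "trivial_rigging J \<longleftrightarrow> surj J \<and> (\<forall>s. norm (J s) = norm s)"

text \<open>The norm in \<open>S'\<close> of \<open>v \<in> U\<close>, which acts on \<open>S\<close> by \<open>s \<mapsto> \<langle>s, v\<rangle>\<^sub>U\<close>.\<close>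

definition dual_norm :: "('s::banach \<Rightarrow> 'u::{real_inner,complete_space}) \<Rightarrow> 'u \<Rightarrow> real" where
  "dual_norm J v = onorm (\<lambda>s. inner (J s) v)"

text \<open>Local Lipschitz continuity is understood as usual for nonlinear perturbations of semigroups
  (Pazy, Chapter 6): Lipschitz on every bounded set. In infinite dimension this is stronger than
  being Lipschitz near each point, which would not bound \<open>\<sigma>\<close> on bounded sets.\<close>

definition D1 :: "('s::banach \<Rightarrow> 'u::{real_inner,complete_space}) \<Rightarrow> ('u \<Rightarrow> 's) \<Rightarrow> bool" where
  "D1 J \<sigma> \<longleftrightarrow> (\<forall>r. \<exists>L. L-lipschitz_on (cball 0 r) (\<lambda>u. J (\<sigma> u)))"

definition D2 :: "('s::banach \<Rightarrow> 'u::{real_inner,complete_space}) \<Rightarrow> ('u \<Rightarrow> 's) \<Rightarrow> bool" where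
  "D2 J \<sigma> \<longleftrightarrow> (\<forall>u v. inner (J (\<sigma> u) - J (\<sigma> v)) (u - v) \<ge> 0)"

definition D3 :: "('s::banach \<Rightarrow> 'u::{real_inner,complete_space}) \<Rightarrow> ('u \<Rightarrow> 's) \<Rightarrow> bool" where
  "D3 J \<sigma> \<longleftrightarrow>
     (\<exists>C1>0. \<exists>C2>0. \<exists>h :: real \<Rightarrow> real.
        continuous_on UNIV h \<and> mono h \<and> (\<forall>x. h x \<ge> 0) \<and> h 0 > 0 \<and>
        (\<forall>s. dual_norm J (J (\<sigma> (J s)) - C1 *\<^sub>R J s)
              \<le> C2 * h (norm s) * inner (J (\<sigma> (J s))) (J s)))"

definition A_sigma ::
    "('h::{real_inner,complete_space} \<Rightarrow> 'h) \<Rightarrow> ('u::{real_inner,complete_space} \<Rightarrow> 'h) \<Rightarrow> real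
     \<Rightarrow> ('s::banach \<Rightarrow> 'u) \<Rightarrow> ('u \<Rightarrow> 's) \<Rightarrow> 'h \<Rightarrow> 'h" where
  "A_sigma A B k J \<sigma> z = A z - sqrt k *\<^sub>R B (J (\<sigma> (sqrt k *\<^sub>R adjoint B z)))"

definition locally_abs_continuous :: "(real \<Rightarrow> 'h::real_normed_vector) \<Rightarrow> bool" where
  "locally_abs_continuous z \<longleftrightarrow>
     (\<forall>T>0. \<forall>\<epsilon>>0. \<exists>\<delta>>0. \<forall>(n::nat) a b.
        (\<forall>i<n. 0 \<le> a i \<and> a i \<le> b i \<and> b i \<le> T) \<longrightarrow>
        disjoint_family_on (\<lambda>i. {a i<..<b i}) {..<n} \<longrightarrow>
        (\<Sum>i<n. b i - a i) < \<delta> \<longrightarrow>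
        (\<Sum>i<n. norm (z (b i) - z (a i))) < \<epsilon>)"

text \<open>A strong solution on \<open>[0, \<infinity>)\<close> of \<open>z' = F z\<close>, \<open>z 0 = z0\<close>, where \<open>F\<close> has domain \<open>D\<close>; the values of
  \<open>z\<close> at negative times are irrelevant.\<close>

definition strong_solution ::
    "'h::real_normed_vector set \<Rightarrow> ('h \<Rightarrow> 'h) \<Rightarrow> 'h \<Rightarrow> (real \<Rightarrow> 'h) \<Rightarrow> bool" where
  "strong_solution D F z0 z \<longleftrightarrow>
     locally_abs_continuous z \<and> z 0 = z0 \<and> (\<forall>t\<ge>0. z t \<in> D) \<and>
     (AE t in lebesgue. t \<ge> 0 \<longrightarrow> (z has_vector_derivative F (z t)) (at t within {0..}))"

definition strict_global_lyapunov ::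
    "'h::real_normed_vector set \<Rightarrow> ('h \<Rightarrow> 'h) \<Rightarrow> ('h \<Rightarrow> real) \<Rightarrow> bool" where
  "strict_global_lyapunov D F V \<longleftrightarrow>
     continuous_on UNIV V \<and> (\<forall>x. V x \<ge> 0) \<and> V 0 = 0 \<and>
     (\<exists>a>0. \<forall>x. V x \<ge> a * (norm x)\<^sup>2) \<and>
     (\<exists>c>0. \<forall>z0 z. strong_solution D F z0 z \<longrightarrow>
        (AE t in lebesgue. t \<ge> 0 \<longrightarrow>
           (\<exists>d. ((\<lambda>\<tau>. V (z \<tau>)) has_real_derivative d) (at t within {0..}) \<and>
                d \<le> - c * (norm (z t))\<^sup>2)))"

text \<open>The estimate is imposed on every strong solution starting at \<open>z0\<close>. Under \<open>D1\<close>, \<open>D2\<close>, \<open>D3\<close> there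
  is exactly one for each \<open>z0 \<in> D\<close>, namely \<open>t \<mapsto> W\<^sub>\<sigma>(t) z0\<close>.\<close>

definition semiglobally_exp_stable ::
    "'h::real_normed_vector set \<Rightarrow> ('h \<Rightarrow> 'h) \<Rightarrow> ('h \<Rightarrow> 'h) \<Rightarrow> bool" where
  "semiglobally_exp_stable D A F \<longleftrightarrow>
     (\<forall>r>0. \<exists>\<mu>>0. \<exists>K>0. \<forall>z0\<in>D. graph_norm A z0 \<le> r \<longrightarrow>
        (\<forall>z. strong_solution D F z0 z \<longrightarrow>
           (\<forall>t\<ge>0. norm (z t) \<le> K * exp (- \<mu> * t) * norm z0)))"

end

theory Submission
  imports Defs
begin

text \<open>The Lyapunov function is \<open>V z = Q z z + \<phi> (\<parallel>z\<parallel>\<^sup>2)\<close>, where the bounded quadratic form \<open>Q\<close> comes from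
  the exponentially stable linear system. Writing \<open>w = \<surd>k B\<^sup>\<star> z\<close>, the nonlinear system is that linear
  system perturbed by \<open>\<surd>k B (w - \<sigma> w)\<close>, so \<open>Q\<close> decreases up to an error controlled by
  \<open>\<parallel>w - \<sigma> w\<parallel>\<close>, while \<open>\<parallel>z\<parallel>\<^sup>2\<close> decreases at least at the rate \<open>2 \<langle>\<sigma> w, w\<rangle>\<close> since \<open>A\<close> is dissipative.
  \<open>D3\<close> (with \<open>D1\<close> when \<open>S \<noteq> U\<close>) bounds the error by the dissipation, with a factor depending on \<open>\<parallel>z\<parallel>\<close> that the choice of
  \<open>\<phi>\<close> compensates. When \<open>S \<noteq> U\<close> this factor depends on \<open>\<parallel>w\<parallel>\<^sub>S\<close>, hence on the graph norm of \<open>z\<close>.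
  The latter is bounded along trajectories: monotonicity makes
  \<open>t \<mapsto> \<parallel>z (t + h) - z t\<parallel>\<close> nonincreasing, so \<open>\<parallel>A\<^sub>\<sigma> (z t)\<parallel> \<le> \<parallel>A\<^sub>\<sigma> z\<^sub>0\<parallel>\<close> for almost every \<open>t\<close>.\<close>

subsection \<open>Absolutely continuous functions\<close>

text \<open>An enumeration of the index set transfers the definition from initial segments of the
  naturals to any finite set, so that the tagged intervals of a division can serve as
  indices.\<close>

lemma locally_abs_continuousD:
  fixes z :: "real \<Rightarrow> 'h::real_normed_vector"
  assumes "locally_abs_continuous z" "T > 0" "\<epsilon> > 0"
  shows "\<exists>\<delta>>0. \<forall>(I::'i set) a b. finite I \<longrightarrow> (\<forall>i\<in>I. 0 \<le> a i \<and> a i \<le> b i \<and> b i \<le> T) \<longrightarrow>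
      disjoint_family_on (\<lambda>i. {a i<..<b i}) I \<longrightarrow> (\<Sum>i\<in>I. b i - a i) < \<delta> \<longrightarrow>
      (\<Sum>i\<in>I. norm (z (b i) - z (a i))) < \<epsilon>"
proof -
  obtain \<delta> where \<delta>: "\<delta> > 0" "\<forall>(n::nat) a b.
        (\<forall>i<n. 0 \<le> a i \<and> a i \<le> b i \<and> b i \<le> T) \<longrightarrow>
        disjoint_family_on (\<lambda>i. {a i<..<b i}) {..<n} \<longrightarrow>
        (\<Sum>i<n. b i - a i) < \<delta> \<longrightarrow>
        (\<Sum>i<n. norm (z (b i) - z (a i))) < \<epsilon>"
    using assms(1)[unfolded locally_abs_continuous_def, rule_format, OF assms(2,3)] by blast
  show ?thesis
  proof (intro exI[of _ \<delta>] conjI allI impI \<delta>(1))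
    fix I :: "'i set" and a b :: "'i \<Rightarrow> real"
    assume fin: "finite I" and ab: "\<forall>i\<in>I. 0 \<le> a i \<and> a i \<le> b i \<and> b i \<le> T"
      and disj: "disjoint_family_on (\<lambda>i. {a i<..<b i}) I" and less: "(\<Sum>i\<in>I. b i - a i) < \<delta>"
    obtain g where g: "bij_betw g {..<card I} I"
      using ex_bij_betw_nat_finite[OF fin] by (auto simp: atLeast0LessThan)
    have gI: "g i \<in> I" if "i < card I" for i
      using g that by (auto simp: bij_betw_def)
    have "(\<Sum>i<card I. norm (z ((b \<circ> g) i) - z ((a \<circ> g) i))) < \<epsilon>"
    proof (rule \<delta>(2)[rule_format, of "card I" "a \<circ> g" "b \<circ> g"])
      fix i assume "i < card I"
      then show "0 \<le> (a \<circ> g) i \<and> (a \<circ> g) i \<le> (b \<circ> g) i \<and> (b \<circ> g) i \<le> T"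
        using ab gI by auto
    next
      show "disjoint_family_on (\<lambda>i. {(a \<circ> g) i<..<(b \<circ> g) i}) {..<card I}"
        unfolding disjoint_family_on_def
      proof (intro ballI impI)
        fix m n assume "m \<in> {..<card I}" "n \<in> {..<card I}" "m \<noteq> n"
        then have "g m \<noteq> g n" "g m \<in> I" "g n \<in> I"
          using g gI by (auto simp: bij_betw_def inj_on_def)
        then show "{(a \<circ> g) m<..<(b \<circ> g) m} \<inter> {(a \<circ> g) n<..<(b \<circ> g) n} = {}"
          using disj unfolding disjoint_family_on_def o_def by blast
      qed
      show "(\<Sum>i<card I. (b \<circ> g) i - (a \<circ> g) i) < \<delta>"
        using less sum.reindex_bij_betw[OF g, of "\<lambda>i. b i - a i"] by simp
    qed
    then show "(\<Sum>i\<in>I. norm (z (b i) - z (a i))) < \<epsilon>"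
      using sum.reindex_bij_betw[OF g, of "\<lambda>i. norm (z (b i) - z (a i))"] by simp
  qed
qed

text \<open>Outer regularity of Lebesgue measure gives \<open>G\<close>; removing the null set
  \<open>N\<close> from it does not change its measure.\<close>

lemma negligible_outer_open:
  fixes N :: "'a::euclidean_space set"
  assumes "negligible N" "\<delta> > 0"
  obtains G where "open G" "N \<subseteq> G" "G \<in> lmeasurable" "measure lebesgue G < \<delta>"
proof -
  have N: "N \<in> null_sets lebesgue" using assms(1) by (simp add: negligible_iff_null_sets)
  then obtain G where G: "open G" "N \<subseteq> G" "G - N \<in> lmeasurable" "emeasure lebesgue (G - N) < ennreal \<delta>"
    using sets_lebesgue_outer_open assms(2) by blast
  have GN: "G = (G - N) \<union> N" using G by auto
  then have "G \<in> lmeasurable" using G(3) assms(1) negligible_imp_measurable by (metis fmeasurable.Un)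
  moreover have "emeasure lebesgue G = emeasure lebesgue (G - N)"
    using G(1,3) N by (metis emeasure_Diff_null_set fmeasurableD calculation)
  ultimately have "measure lebesgue G < \<delta>"
    using G(4) assms(2) by (metis emeasure_eq_measure2 ennreal_less_iff measure_nonneg)
  with G(1,2) \<open>G \<in> lmeasurable\<close> show thesis using that by blast
qed

lemma sum_lengths_le_measure:
  fixes a b :: "'i \<Rightarrow> real"
  assumes "finite I" "\<And>i. i \<in> I \<Longrightarrow> a i \<le> b i \<and> {a i<..<b i} \<subseteq> G"
    "disjoint_family_on (\<lambda>i. {a i<..<b i}) I" "G \<in> lmeasurable"
  shows "(\<Sum>i\<in>I. b i - a i) \<le> measure lebesgue G"
proof -
  have "(\<Sum>i\<in>I. b i - a i) = (\<Sum>i\<in>I. measure lebesgue {a i<..<b i})"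
    using assms(2) by (intro sum.cong) auto
  also have "\<dots> = measure lebesgue (\<Union>i\<in>I. {a i<..<b i})"
    using assms(1,3)
    by (intro measure_UNION'[symmetric])
       (auto simp: pairwise_def disjnt_def disjoint_family_on_def)
  also have "\<dots> \<le> measure lebesgue G"
    using assms by (intro measure_mono_fmeasurable) auto
  finally show ?thesis .
qed

text \<open>A straddle lemma as in Henstock-Kurzweil integration: \<open>x\<close> lies between
  \<open>u\<close> and \<open>v\<close>, so the linearization errors at the two endpoints add up to
  at most \<open>e * (v - u)\<close>, and the linear term is nonpositive.\<close>

lemma straddle_nonpos:
  fixes f :: "real \<Rightarrow> real"
  assumes f: "(f has_real_derivative d) (at x within {0..})" and d: "d \<le> 0" and e: "e > 0"
  obtains r where "r > 0"
    "\<And>u v. \<lbrakk>0 \<le> u; u \<le> x; x \<le> v; u \<in> ball x r; v \<in> ball x r\<rbrakk> \<Longrightarrow> f v - f u \<le> e * (v - u)"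
proof -
  have "(f has_derivative (*) d) (at x within {0..})"
    using f by (simp add: has_field_derivative_def)
  then obtain r where r: "r > 0"
    "\<And>y. y \<ge> 0 \<Longrightarrow> norm (y - x) < r \<Longrightarrow> norm (f y - f x - d * (y - x)) \<le> e * norm (y - x)"
    unfolding has_derivative_within_alt using e by (metis atLeast_iff)
  show thesis
  proof (rule that[OF r(1)])
    fix u v assume uv: "0 \<le> u" "u \<le> x" "x \<le> v" "u \<in> ball x r" "v \<in> ball x r"
    have 1: "norm (f v - f x - d * (v - x)) \<le> e * norm (v - x)"
      using uv by (intro r(2)) (auto simp: dist_norm)
    have 2: "norm (f u - f x - d * (u - x)) \<le> e * norm (u - x)"
      using uv by (intro r(2)) (auto simp: dist_norm)
    have "f v - f u \<le> d * (v - u) + e * (v - u)"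
      using 1 2 uv by (auto simp: algebra_simps abs_le_iff)
    moreover have "d * (v - u) \<le> 0" using d uv by (simp add: mult_nonpos_nonneg)
    ultimately show "f v - f u \<le> e * (v - u)" by linarith
  qed
qed

text \<open>On a fine tagged division, the intervals tagged in the exceptional null set have small total
  length, so absolute continuity bounds their contribution; on the others the derivative does.\<close>

lemma AE_deriv_nonpos_imp_le:
  fixes f :: "real \<Rightarrow> real"
  assumes lac: "locally_abs_continuous f"
    and ae: "AE t in lebesgue. t \<ge> 0 \<longrightarrow> (\<exists>d\<le>0. (f has_real_derivative d) (at t within {0..}))"
    and st: "0 \<le> s" "s \<le> t"
  shows "f t \<le> f s"
proof (cases "s = t")
  case False
  with st have st': "s < t" and t0: "t > 0" by auto
  have "f t - f s \<le> 0 + e" if e: "e > 0" for e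
  proof -
    \<comment> \<open>Half of \<open>e\<close> is spread over the interval at rate
      \<open>e1\<close>; the other half is kept for the intervals tagged in the null set.\<close>
    define e1 where "e1 = e / (2 * (t - s))"
    have e1: "e1 > 0" using e st' by (simp add: e1_def)
    obtain \<delta> where \<delta>: "\<delta> > 0"
      "\<forall>(I::(real \<times> real set) set) a b. finite I \<longrightarrow> (\<forall>i\<in>I. 0 \<le> a i \<and> a i \<le> b i \<and> b i \<le> t) \<longrightarrow>
      disjoint_family_on (\<lambda>i. {a i<..<b i}) I \<longrightarrow> (\<Sum>i\<in>I. b i - a i) < \<delta> \<longrightarrow>
      (\<Sum>i\<in>I. norm (f (b i) - f (a i))) < e/2"
      using locally_abs_continuousD[OF lac t0 half_gt_zero[OF e]] by blast
    obtain N where N0: "N \<in> null_sets lebesgue"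
      "{x \<in> space lebesgue. \<not> (x \<ge> 0 \<longrightarrow> (\<exists>d\<le>0. (f has_real_derivative d) (at x within {0..})))} \<subseteq> N"
      using ae unfolding eventually_ae_filter by blast
    have N: "N \<in> null_sets lebesgue"
      "\<And>x. x \<notin> N \<Longrightarrow> x \<ge> 0 \<Longrightarrow> \<exists>d\<le>0. (f has_real_derivative d) (at x within {0..})"
      using N0 by auto
    obtain G where G: "open G" "N \<subseteq> G" "G \<in> lmeasurable" "measure lebesgue G < \<delta>"
      using negligible_outer_open[of N \<delta>] N(1) \<delta>(1) by (auto simp: negligible_iff_null_sets)
    \<comment> \<open>The radius of the gauge keeps exceptional tags inside the small open set
      \<open>G\<close> and makes the straddle estimate valid at all other tags.\<close>
    have "\<exists>r>0. (x \<in> N \<longrightarrow> ball x r \<subseteq> G) \<and>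
      (x \<notin> N \<longrightarrow> (\<forall>u v. 0 \<le> u \<longrightarrow> u \<le> x \<longrightarrow> x \<le> v \<longrightarrow> u \<in> ball x r \<longrightarrow> v \<in> ball x r \<longrightarrow>
          f v - f u \<le> e1 * (v - u)))" for x
    proof (cases "x \<in> N")
      case True
      then show ?thesis using G open_contains_ball by blast
    next
      case False
      show ?thesis
      proof (cases "x \<ge> 0")
        case True
        then obtain d where "d \<le> 0" "(f has_real_derivative d) (at x within {0..})"
          using N(2)[OF False] by auto
        from straddle_nonpos[OF this(2,1) e1] show ?thesis using False by metis
      next
        case neg: False
        \<comment> \<open>For negative \<open>x\<close> no \<open>u\<close> satisfies the premises,
          so any radius serves.\<close>
        then show ?thesis using False by (intro exI[of _ 1]) auto
      qed
    qed
    then obtain r where r: "\<And>x. r x > 0" "\<And>x. x \<in> N \<Longrightarrow> ball x (r x) \<subseteq> G"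
      "\<And>x u v. \<lbrakk>x \<notin> N; 0 \<le> u; u \<le> x; x \<le> v; u \<in> ball x (r x); v \<in> ball x (r x)\<rbrakk>
         \<Longrightarrow> f v - f u \<le> e1 * (v - u)"
      by metis
    have "gauge (\<lambda>x. ball x (r x))" using r(1) by (simp add: gauge_def)
    then obtain p where p: "p tagged_division_of {s..t}" "(\<lambda>x. ball x (r x)) fine p"
      using fine_division_exists_real by blast
    have fin: "finite p" using p(1) by blast
    define a b where "a = (\<lambda>i::real \<times> real set. Inf (snd i))" and "b = (\<lambda>i::real \<times> real set. Sup (snd i))"
    have K: "snd i = {a i..b i} \<and> a i \<le> fst i \<and> fst i \<le> b i \<and> s \<le> a i \<and> b i \<le> t \<and>
        a i \<in> ball (fst i) (r (fst i)) \<and> b i \<in> ball (fst i) (r (fst i)) \<and>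
        {a i..b i} \<subseteq> ball (fst i) (r (fst i))" if "i \<in> p" for i
    proof -
      have i: "(fst i, snd i) \<in> p" using that by simp
      obtain u v where uv: "snd i = cbox u v" using tagged_division_ofD(4)[OF p(1) i] by blast
      have x: "fst i \<in> snd i" "snd i \<subseteq> {s..t}"
        using tagged_division_ofD(2,3)[OF p(1) i] by blast+
      have le: "u \<le> v" using x(1) uv by auto
      have au: "a i = u" "b i = v" using uv le by (auto simp: a_def b_def)
      have "snd i \<subseteq> ball (fst i) (r (fst i))" using fineD[OF p(2) i] .
      moreover from this have "u \<in> ball (fst i) (r (fst i))" "v \<in> ball (fst i) (r (fst i))"
        using uv le by auto
      ultimately show ?thesis using x uv au by auto
    qed
    have disj: "disjoint_family_on (\<lambda>i. {a i<..<b i}) p"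
      unfolding disjoint_family_on_def
    proof (intro ballI impI)
      fix i j assume ij: "i \<in> p" "j \<in> p" "i \<noteq> j"
      then have "interior (snd i) \<inter> interior (snd j) = {}"
        using tagged_division_ofD(5)[OF p(1), of "fst i" "snd i" "fst j" "snd j"] by auto
      then show "{a i<..<b i} \<inter> {a j<..<b j} = {}"
        using K[OF ij(1)] K[OF ij(2)] by (metis interior_atLeastAtMost_real)
    qed
    define p1 where "p1 = {i\<in>p. fst i \<in> N}"
    have p1: "p1 \<subseteq> p" "finite p1" using fin by (auto simp: p1_def)
    have disj1: "disjoint_family_on (\<lambda>i. {a i<..<b i}) p1"
      using disj p1(1) by (rule disjoint_family_on_mono[rotated])
    have "(\<Sum>i\<in>p1. b i - a i) \<le> measure lebesgue G"
    proof (rule sum_lengths_le_measure[OF p1(2) _ disj1 G(3)])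
      fix i assume i: "i \<in> p1"
      then have "{a i..b i} \<subseteq> G" "a i \<le> b i" using K[of i] r(2)[of "fst i"] by (auto simp: p1_def)
      then show "a i \<le> b i \<and> {a i<..<b i} \<subseteq> G" by auto
    qed
    then have "(\<Sum>i\<in>p1. norm (f (b i) - f (a i))) < e/2"
    proof (intro \<delta>(2)[rule_format, OF p1(2) _ disj1])
      fix i assume "i \<in> p1"
      then have "i \<in> p" using p1 by auto
      from K[OF this] show "0 \<le> a i \<and> a i \<le> b i \<and> b i \<le> t" using st by auto
    qed (use G in auto)
    moreover have "(\<Sum>i\<in>p1. f (b i) - f (a i)) \<le> (\<Sum>i\<in>p1. norm (f (b i) - f (a i)))"
      by (intro sum_mono) simp
    moreover have "(\<Sum>i\<in>p-p1. f (b i) - f (a i)) \<le> (\<Sum>i\<in>p-p1. e1 * (b i - a i))"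
    proof (rule sum_mono)
      fix i assume i: "i \<in> p - p1"
      then show "f (b i) - f (a i) \<le> e1 * (b i - a i)"
        using K[of i] st by (intro r(3)[of "fst i"]) (auto simp: p1_def)
    qed
    moreover have "(\<Sum>i\<in>p-p1. e1 * (b i - a i)) \<le> (\<Sum>i\<in>p. e1 * (b i - a i))"
      using K e1 by (intro sum_mono2[OF fin]) (auto intro!: mult_nonneg_nonneg, force)
    moreover have "(\<Sum>i\<in>p. e1 * (b i - a i)) = e1 * (t - s)"
      using additive_tagged_division_1[OF st(2) p(1), of "\<lambda>x. x"]
      by (simp add: sum_distrib_left[symmetric] a_def b_def case_prod_beta)
    moreover have "e1 * (t - s) = e/2" using st' by (simp add: e1_def field_simps)
    moreover have "(\<Sum>i\<in>p. f (b i) - f (a i)) = f t - f s"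
      using additive_tagged_division_1[OF st(2) p(1), of f] by (simp add: a_def b_def case_prod_beta)
    moreover have "(\<Sum>i\<in>p. f (b i) - f (a i)) = (\<Sum>i\<in>p-p1. f (b i) - f (a i)) + (\<Sum>i\<in>p1. f (b i) - f (a i))"
      by (rule sum.subset_diff[OF p1(1) fin])
    ultimately show ?thesis by linarith
  qed
  then have "f t - f s \<le> 0" by (rule field_le_epsilon)
  then show ?thesis by simp
qed simp

section \<open>Permanence properties of local absolute continuity\<close>

text \<open>Increments of \<open>u\<close> are controlled by those of \<open>f\<close> and
  \<open>g\<close>, so the smaller of their two \<delta> works. The range spaces may differ, so one
  criterion covers sums, products and real functions of vector trajectories.\<close>

lemma locally_abs_continuous_dominated:
  fixes f :: "real \<Rightarrow> 'a::real_normed_vector" and g :: "real \<Rightarrow> 'b::real_normed_vector"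
    and u :: "real \<Rightarrow> 'c::real_normed_vector"
  assumes f: "locally_abs_continuous f" and g: "locally_abs_continuous g"
    and le: "\<And>T. T > 0 \<Longrightarrow> \<exists>L. \<forall>s\<in>{0..T}. \<forall>t\<in>{0..T}.
      norm (u t - u s) \<le> L * (norm (f t - f s) + norm (g t - g s))"
  shows "locally_abs_continuous u"
  unfolding locally_abs_continuous_def
proof (intro allI impI)
  fix T \<epsilon> :: real assume T: "T > 0" and \<epsilon>: "\<epsilon> > 0"
  obtain L where L: "\<And>s t. \<lbrakk>s \<in> {0..T}; t \<in> {0..T}\<rbrakk> \<Longrightarrow>
      norm (u t - u s) \<le> L * (norm (f t - f s) + norm (g t - g s))"
    using le[OF T] by blast
  \<comment> \<open>\<open>L\<close> may be zero or negative, whereas \<epsilon> has to be divided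
    by a positive bound.\<close>
  define M where "M = \<bar>L\<bar> + 1"
  have M: "M > 0" "L \<le> M" by (auto simp: M_def)
  have \<epsilon>': "\<epsilon> / (2 * M) > 0" using \<epsilon> M by simp
  obtain \<delta>1 where 1: "\<delta>1 > 0" "\<forall>(n::nat) a b.
        (\<forall>i<n. 0 \<le> a i \<and> a i \<le> b i \<and> b i \<le> T) \<longrightarrow> disjoint_family_on (\<lambda>i. {a i<..<b i}) {..<n} \<longrightarrow>
        (\<Sum>i<n. b i - a i) < \<delta>1 \<longrightarrow> (\<Sum>i<n. norm (f (b i) - f (a i))) < \<epsilon> / (2 * M)"
    using f[unfolded locally_abs_continuous_def, rule_format, OF T \<epsilon>'] by blast
  obtain \<delta>2 where 2: "\<delta>2 > 0" "\<forall>(n::nat) a b.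
        (\<forall>i<n. 0 \<le> a i \<and> a i \<le> b i \<and> b i \<le> T) \<longrightarrow> disjoint_family_on (\<lambda>i. {a i<..<b i}) {..<n} \<longrightarrow>
        (\<Sum>i<n. b i - a i) < \<delta>2 \<longrightarrow> (\<Sum>i<n. norm (g (b i) - g (a i))) < \<epsilon> / (2 * M)"
    using g[unfolded locally_abs_continuous_def, rule_format, OF T \<epsilon>'] by blast
  show "\<exists>\<delta>>0. \<forall>(n::nat) a b.
        (\<forall>i<n. 0 \<le> a i \<and> a i \<le> b i \<and> b i \<le> T) \<longrightarrow>
        disjoint_family_on (\<lambda>i. {a i<..<b i}) {..<n} \<longrightarrow>
        (\<Sum>i<n. b i - a i) < \<delta> \<longrightarrow>
        (\<Sum>i<n. norm (u (b i) - u (a i))) < \<epsilon>"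
  proof (intro exI[of _ "min \<delta>1 \<delta>2"] conjI allI impI)
    fix n :: nat and a b :: "nat \<Rightarrow> real"
    assume ab: "\<forall>i<n. 0 \<le> a i \<and> a i \<le> b i \<and> b i \<le> T"
      and d: "disjoint_family_on (\<lambda>i. {a i<..<b i}) {..<n}"
      and l: "(\<Sum>i<n. b i - a i) < min \<delta>1 \<delta>2"
    have "norm (u (b i) - u (a i)) \<le> M * (norm (f (b i) - f (a i)) + norm (g (b i) - g (a i)))"
      if "i < n" for i
    proof -
      have "a i \<in> {0..T}" "b i \<in> {0..T}" using ab that by fastforce+
      from L[OF this] show ?thesis
        by (rule order_trans) (intro mult_right_mono M add_nonneg_nonneg norm_ge_zero)
    qed
    then have "(\<Sum>i<n. norm (u (b i) - u (a i)))
      \<le> (\<Sum>i<n. M * (norm (f (b i) - f (a i)) + norm (g (b i) - g (a i))))"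
      by (intro sum_mono) auto
    also have "\<dots> = M * ((\<Sum>i<n. norm (f (b i) - f (a i))) + (\<Sum>i<n. norm (g (b i) - g (a i))))"
      by (simp only: sum.distrib sum_distrib_left[symmetric])
    also have "\<dots> < M * (\<epsilon> / (2 * M) + \<epsilon> / (2 * M))"
      using 1(2)[rule_format, of n a b] 2(2)[rule_format, of n a b] ab d l M by (intro mult_strict_left_mono add_strict_mono) auto
    also have "\<dots> = \<epsilon>" using M by (simp add: field_simps)
    finally show "(\<Sum>i<n. norm (u (b i) - u (a i))) < \<epsilon>" .
  qed (use 1 2 in auto)
qed

lemma locally_abs_continuous_imp_continuous_on:
  fixes z :: "real \<Rightarrow> 'h::real_normed_vector"
  assumes "locally_abs_continuous z"
  shows "continuous_on {0..T} z"
  unfolding continuous_on_iff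
proof (intro ballI allI impI)
  fix x \<epsilon> :: real assume x: "x \<in> {0..T}" and \<epsilon>: "\<epsilon> > 0"
  \<comment> \<open>\<open>T\<close> may be 0, but the definition speaks of positive horizons
    only.\<close>
  have "T + 1 > 0" using x by auto
  then obtain \<delta> where \<delta>: "\<delta> > 0"
    "\<forall>(I::nat set) a b. finite I \<longrightarrow> (\<forall>i\<in>I. 0 \<le> a i \<and> a i \<le> b i \<and> b i \<le> T + 1) \<longrightarrow>
      disjoint_family_on (\<lambda>i. {a i<..<b i}) I \<longrightarrow> (\<Sum>i\<in>I. b i - a i) < \<delta> \<longrightarrow>
      (\<Sum>i\<in>I. norm (z (b i) - z (a i))) < \<epsilon>"
    using locally_abs_continuousD[OF assms \<open>T + 1 > 0\<close> \<epsilon>] by blast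
  have small: "norm (z t - z s) < \<epsilon>" if "s \<le> t" "t - s < \<delta>" "s \<ge> 0" "t \<le> T" for s t
    using \<delta>(2)[rule_format, of "{0}" "\<lambda>_. s" "\<lambda>_. t"] that by (auto simp: disjoint_family_on_def)
  show "\<exists>d>0. \<forall>x'\<in>{0..T}. dist x' x < d \<longrightarrow> dist (z x') (z x) < \<epsilon>"
  proof (intro exI[of _ \<delta>] conjI ballI impI \<delta>(1))
    fix y assume y: "y \<in> {0..T}" "dist y x < \<delta>"
    then show "dist (z y) (z x) < \<epsilon>"
      using small[of x y] small[of y x] x by (cases "x \<le> y") (auto simp: dist_norm norm_minus_commute)
  qed
qed

lemma locally_abs_continuous_bounded:
  fixes z :: "real \<Rightarrow> 'h::real_normed_vector"
  assumes "locally_abs_continuous z"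
  shows "\<exists>M>0. \<forall>t\<in>{0..T}. norm (z t) \<le> M"
proof -
  have "bounded (z ` {0..T})"
    using assms locally_abs_continuous_imp_continuous_on compact_continuous_image
      compact_imp_bounded compact_Icc by metis
  then show ?thesis by (auto simp: bounded_pos)
qed

text \<open>The identity, for which \<delta> = \<epsilon> works, serves as both dominating
  functions; this is why the constant is halved.\<close>

lemma locally_abs_continuous_lipschitz:
  fixes u :: "real \<Rightarrow> 'c::real_normed_vector"
  assumes "\<And>T. T > 0 \<Longrightarrow> \<exists>L. \<forall>s\<in>{0..T}. \<forall>t\<in>{0..T}. norm (u t - u s) \<le> L * \<bar>t - s\<bar>"
  shows "locally_abs_continuous u"
proof -
  have id: "locally_abs_continuous (\<lambda>t::real. t)"
    unfolding locally_abs_continuous_def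
  proof (intro allI impI)
    fix T \<epsilon> :: real assume \<epsilon>: "\<epsilon> > 0"
    show "\<exists>\<delta>>0. \<forall>(n::nat) a b. (\<forall>i<n. 0 \<le> a i \<and> a i \<le> b i \<and> b i \<le> T) \<longrightarrow>
        disjoint_family_on (\<lambda>i. {a i<..<b i}) {..<n} \<longrightarrow>
        (\<Sum>i<n. b i - a i) < \<delta> \<longrightarrow> (\<Sum>i<n. norm (b i - a i)) < \<epsilon>"
      using \<epsilon> by (intro exI[of _ \<epsilon>]) (auto cong: sum.cong_simp)
  qed
  show ?thesis
  proof (rule locally_abs_continuous_dominated[OF id id])
    fix T :: real assume "T > 0"
    then obtain L where "\<forall>s\<in>{0..T}. \<forall>t\<in>{0..T}. norm (u t - u s) \<le> L * \<bar>t - s\<bar>" using assms by blast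
    then show "\<exists>L. \<forall>s\<in>{0..T}. \<forall>t\<in>{0..T}. norm (u t - u s) \<le> L * (norm (t - s) + norm (t - s))"
      by (intro exI[of _ "L/2"]) auto
  qed
qed

lemma locally_abs_continuous_diff:
  fixes f g :: "real \<Rightarrow> 'c::real_normed_vector"
  assumes "locally_abs_continuous f" "locally_abs_continuous g"
  shows "locally_abs_continuous (\<lambda>t. f t - g t)"
proof (rule locally_abs_continuous_dominated[OF assms], intro exI[of _ 1] ballI)
  fix s t
  show "norm (f t - g t - (f s - g s)) \<le> 1 * (norm (f t - f s) + norm (g t - g s))"
    using norm_triangle_ineq4[of "f t - f s" "g t - g s"] by (simp add: algebra_simps)
qed

lemma locally_abs_continuous_add:
  fixes f g :: "real \<Rightarrow> 'c::real_normed_vector"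
  assumes "locally_abs_continuous f" "locally_abs_continuous g"
  shows "locally_abs_continuous (\<lambda>t. f t + g t)"
proof (rule locally_abs_continuous_dominated[OF assms], intro exI[of _ 1] ballI)
  fix s t
  show "norm (f t + g t - (f s + g s)) \<le> 1 * (norm (f t - f s) + norm (g t - g s))"
    using norm_triangle_ineq[of "f t - f s" "g t - g s"] by (simp add: algebra_simps)
qed

text \<open>The increment splits as in the product rule, and both factors are bounded on compact
  intervals. Applied to the inner product, to \<open>Q\<close> and to real multiplication.\<close>

lemma locally_abs_continuous_bilinear:
  fixes f :: "real \<Rightarrow> 'a::real_normed_vector" and g :: "real \<Rightarrow> 'b::real_normed_vector"
    and prod :: "'a \<Rightarrow> 'b \<Rightarrow> 'c::real_normed_vector"
  assumes bil: "bounded_bilinear prod" and f: "locally_abs_continuous f" and g: "locally_abs_continuous g"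
  shows "locally_abs_continuous (\<lambda>t. prod (f t) (g t))"
proof (rule locally_abs_continuous_dominated[OF f g])
  interpret bounded_bilinear prod by (rule bil)
  fix T :: real
  obtain K where K: "K > 0" "\<And>a b. norm (prod a b) \<le> norm a * norm b * K"
    using pos_bounded by blast
  obtain M1 where M1: "M1 > 0" "\<And>t. t \<in> {0..T} \<Longrightarrow> norm (f t) \<le> M1"
    using locally_abs_continuous_bounded[OF f] by blast
  obtain M2 where M2: "M2 > 0" "\<And>t. t \<in> {0..T} \<Longrightarrow> norm (g t) \<le> M2"
    using locally_abs_continuous_bounded[OF g] by blast
  define M where "M = max M1 M2"
  show "\<exists>L. \<forall>s\<in>{0..T}. \<forall>t\<in>{0..T}. norm (prod (f t) (g t) - prod (f s) (g s))
      \<le> L * (norm (f t - f s) + norm (g t - g s))"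
  proof (intro exI[of _ "M * K"] ballI)
    fix s t assume st: "s \<in> {0..T}" "t \<in> {0..T}"
    have M: "norm (f t) \<le> M" "norm (g s) \<le> M"
      using M1(2)[OF st(2)] M2(2)[OF st(1)] by (auto simp: M_def)
    have "prod (f t) (g t) - prod (f s) (g s) = prod (f t - f s) (g s) + prod (f t) (g t - g s)"
      by (simp add: diff_left diff_right)
    then have "norm (prod (f t) (g t) - prod (f s) (g s))
      \<le> norm (prod (f t - f s) (g s)) + norm (prod (f t) (g t - g s))"
      by (metis norm_triangle_ineq)
    also have "\<dots> \<le> norm (f t - f s) * norm (g s) * K + norm (f t) * norm (g t - g s) * K"
      using K(2) add_mono by blast
    also have "\<dots> \<le> norm (f t - f s) * M * K + M * norm (g t - g s) * K"
      using M K(1) by (intro add_mono mult_right_mono mult_left_mono) auto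
    finally show "norm (prod (f t) (g t) - prod (f s) (g s)) \<le> M * K * (norm (f t - f s) + norm (g t - g s))"
      by (simp add: algebra_simps)
  qed
qed

lemma locally_abs_continuous_shift:
  fixes z :: "real \<Rightarrow> 'h::real_normed_vector"
  assumes "locally_abs_continuous z" "h \<ge> 0"
  shows "locally_abs_continuous (\<lambda>t. z (t + h))"
  unfolding locally_abs_continuous_def
proof (intro allI impI)
  fix T \<epsilon> :: real assume T: "T > 0" and \<epsilon>: "\<epsilon> > 0"
  have "T + h > 0" using T assms by auto
  then obtain \<delta> where \<delta>: "\<delta> > 0"
    "\<forall>(I::nat set) a b. finite I \<longrightarrow> (\<forall>i\<in>I. 0 \<le> a i \<and> a i \<le> b i \<and> b i \<le> T + h) \<longrightarrow>
      disjoint_family_on (\<lambda>i. {a i<..<b i}) I \<longrightarrow> (\<Sum>i\<in>I. b i - a i) < \<delta> \<longrightarrow>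
      (\<Sum>i\<in>I. norm (z (b i) - z (a i))) < \<epsilon>"
    using locally_abs_continuousD[OF assms(1) \<open>T + h > 0\<close> \<epsilon>] by blast
  show "\<exists>\<delta>>0. \<forall>(n::nat) a b. (\<forall>i<n. 0 \<le> a i \<and> a i \<le> b i \<and> b i \<le> T) \<longrightarrow>
        disjoint_family_on (\<lambda>i. {a i<..<b i}) {..<n} \<longrightarrow>
        (\<Sum>i<n. b i - a i) < \<delta> \<longrightarrow> (\<Sum>i<n. norm (z (b i + h) - z (a i + h))) < \<epsilon>"
  proof (intro exI[of _ \<delta>] conjI allI impI \<delta>(1))
    fix n :: nat and a b :: "nat \<Rightarrow> real"
    assume ab: "\<forall>i<n. 0 \<le> a i \<and> a i \<le> b i \<and> b i \<le> T"
      and d: "disjoint_family_on (\<lambda>i. {a i<..<b i}) {..<n}"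
      and l: "(\<Sum>i<n. b i - a i) < \<delta>"
    show "(\<Sum>i<n. norm (z (b i + h) - z (a i + h))) < \<epsilon>"
    proof (rule \<delta>(2)[rule_format])
      show "disjoint_family_on (\<lambda>i. {a i + h<..<b i + h}) {..<n}"
        unfolding disjoint_family_on_def
      proof (intro ballI impI)
        fix i j assume "i \<in> {..<n}" "j \<in> {..<n}" "i \<noteq> j"
        then have *: "{a i<..<b i} \<inter> {a j<..<b j} = {}"
          using d unfolding disjoint_family_on_def by blast
        show "{a i + h<..<b i + h} \<inter> {a j + h<..<b j + h} = {}"
        proof (rule ccontr)
          assume "\<not> ?thesis"
          then obtain x where "x \<in> {a i + h<..<b i + h}" "x \<in> {a j + h<..<b j + h}" by blast
          then have "x - h \<in> {a i<..<b i} \<inter> {a j<..<b j}" by auto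
          with * show False by blast
        qed
      qed
    qed (use ab l assms in \<open>auto simp: add_increasing2\<close>)
  qed
qed

lemma AE_lebesgue_shift:
  fixes P :: "real \<Rightarrow> bool"
  assumes "AE t in lebesgue. P t"
  shows "AE t in lebesgue. P (t + h)"
proof -
  obtain N where N: "N \<in> null_sets lebesgue" "{t. \<not> P t} \<subseteq> N"
    using assms unfolding eventually_ae_filter by auto
  have "negligible ((+) (- h) ` N)"
    using N(1) by (intro negligible_translation) (simp add: negligible_iff_null_sets)
  moreover have "{t. \<not> P (t + h)} \<subseteq> (+) (- h) ` N"
    using N(2) by (force simp: image_iff)
  ultimately show ?thesis unfolding eventually_ae_filter negligible_iff_null_sets by auto
qed

subsection \<open>Adjoints and semigroups\<close>

text \<open>The representing vector minimizes \<open>\<phi> x = (norm x)\<^sup>2 - 2 * f x\<close>.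
  The parallelogram law, applied to the midpoint of two points, makes minimizing sequences Cauchy;
  the vanishing first variation at the minimizer is the representation.\<close>

lemma riesz_representation:
  fixes f :: "'u::{real_inner,complete_space} \<Rightarrow> real"
  assumes "bounded_linear f"
  obtains y where "\<And>x. f x = inner x y"
proof -
  note add = linear_add[OF bounded_linear.linear[OF assms]]
    and scaleR = linear_cmul[OF bounded_linear.linear[OF assms]]
  define \<phi> where "\<phi> = (\<lambda>x. (norm x)\<^sup>2 - 2 * f x)"
  obtain K where K: "\<And>x. norm (f x) \<le> norm x * K" using bounded_linear.bounded[OF assms] by blast
  have lower: "- K\<^sup>2 \<le> \<phi> x" for x
  proof -
    have "f x \<le> norm x * K" using K[of x] by simp
    moreover have "0 \<le> (norm x - K)\<^sup>2" by simp
    ultimately show ?thesis unfolding \<phi>_def power2_diff by (simp add: algebra_simps)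
  qed
  define m where "m = Inf (range \<phi>)"
  have bdd: "bdd_below (range \<phi>)" using lower by (intro bdd_belowI2)
  have m: "m \<le> \<phi> x" for x unfolding m_def by (rule cInf_lower[OF _ bdd]) simp
  have "\<exists>x. \<phi> x < m + 1 / real (Suc n)" for n
    using cInf_lessD[of "range \<phi>" "m + 1 / real (Suc n)"] by (auto simp: m_def)
  then obtain X where X: "\<And>n. \<phi> (X n) < m + 1 / real (Suc n)" by metis
  have gap: "(norm (x - y))\<^sup>2 \<le> 2 * (\<phi> x - m) + 2 * (\<phi> y - m)" for x y
  proof -
    have "\<phi> ((1/2) *\<^sub>R (x + y)) = (norm (x + y))\<^sup>2 / 4 - f x - f y"
    proof -
      have "f ((1/2) *\<^sub>R (x + y)) = (f x + f y) / 2" by (simp add: scaleR add)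
      moreover have "norm ((1/2) *\<^sub>R (x + y)) = norm (x + y) / 2" unfolding norm_scaleR by simp
      ultimately show ?thesis by (simp add: \<phi>_def power_divide)
    qed
    then have "m \<le> (norm (x + y))\<^sup>2 / 4 - f x - f y" using m by metis
    moreover have "(norm (x - y))\<^sup>2 = 2 * (norm x)\<^sup>2 + 2 * (norm y)\<^sup>2 - (norm (x + y))\<^sup>2"
      by (simp add: power2_norm_eq_inner inner_add inner_diff inner_commute)
    ultimately show ?thesis unfolding \<phi>_def by simp
  qed
  have "Cauchy X"
  proof (rule metric_CauchyI)
    fix e :: real assume e: "e > 0"
    then obtain N where N: "1 / real (Suc N) < e\<^sup>2 / 4"
      using reals_Archimedean[of "e\<^sup>2/4"] by (auto simp: inverse_eq_divide)
    have "dist (X i) (X j) < e" if "i \<ge> N" "j \<ge> N" for i j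
    proof -
      have "1 / real (Suc i) \<le> 1 / real (Suc N)" "1 / real (Suc j) \<le> 1 / real (Suc N)"
        using that by (auto simp: frac_le)
      from this[THEN le_less_trans, OF N]
      have "\<phi> (X i) < m + e\<^sup>2 / 4" "\<phi> (X j) < m + e\<^sup>2 / 4"
        using X by (meson add_strict_left_mono less_trans)+
      then have "(norm (X i - X j))\<^sup>2 < 4 * (e\<^sup>2 / 4)" using gap[of "X i" "X j"] by argo
      also have "\<dots> = e\<^sup>2" by simp
      finally show ?thesis using e by (auto simp: dist_norm dest: power2_less_imp_less)
    qed
    then show "\<exists>M. \<forall>i\<ge>M. \<forall>j\<ge>M. dist (X i) (X j) < e" by blast
  qed
  then obtain y where y: "X \<longlonglongrightarrow> y" using Cauchy_convergent convergent_def by blast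
  have "(\<lambda>n. \<phi> (X n)) \<longlonglongrightarrow> \<phi> y"
    unfolding \<phi>_def by (intro tendsto_intros y bounded_linear.tendsto[OF assms])
  moreover have "(\<lambda>n. m + 1 / real (Suc n)) \<longlonglongrightarrow> m + 0"
    by (intro tendsto_add tendsto_const LIMSEQ_Suc lim_1_over_n)
  ultimately have "\<phi> y \<le> m + 0"
    by (rule LIMSEQ_le) (use X in \<open>auto intro!: exI[of _ 0] less_imp_le simp del: of_nat_Suc\<close>)
  then have min: "\<phi> y \<le> \<phi> x" for x using m[of x] by simp
  have "f x = inner x y" for x
  proof (rule ccontr)
    assume "f x \<noteq> inner x y"
    define c where "c = inner x y - f x"
    \<comment> \<open>The added 1 avoids a division by zero. With \<open>t = - c / n\<close> the
      increment of \<phi> is \<open>- t\<^sup>2 * (n + 1)\<close>, which contradicts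
      minimality.\<close>
    define n where "n = (norm x)\<^sup>2 + 1"
    have n: "n > 0" "(norm x)\<^sup>2 = n - 1" by (auto simp: n_def add_nonneg_pos)
    have c: "c \<noteq> 0" using \<open>f x \<noteq> inner x y\<close> by (simp add: c_def)
    define t where "t = - c / n"
    have tn: "t * n = - c" using n by (simp add: t_def)
    have "\<phi> (y + t *\<^sub>R x) = \<phi> y + 2 * t * c + t\<^sup>2 * (norm x)\<^sup>2"
      unfolding \<phi>_def c_def add scaleR power2_norm_eq_inner
      by (simp add: inner_add inner_commute algebra_simps power2_eq_square)
    moreover have "2 * t * c + t\<^sup>2 * (norm x)\<^sup>2 = - t\<^sup>2 * (n + 1)"
    proof -
      have "c = - t * n" using tn by simp
      then show ?thesis unfolding n(2) by (simp add: algebra_simps power2_eq_square)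
    qed
    ultimately have "t\<^sup>2 * (n + 1) \<le> 0" using min[of "y + t *\<^sub>R x"] by simp
    moreover have "t\<^sup>2 * (n + 1) > 0" using c n by (simp add: t_def)
    ultimately show False by simp
  qed
  then show thesis by (rule that)
qed

text \<open>\<open>adjoint\<close> is defined by choice, so its characteristic identity requires
  that some adjoint exists; Riesz representation supplies its values pointwise.\<close>

lemma inner_adjoint:
  fixes B :: "'u::{real_inner,complete_space} \<Rightarrow> 'h::real_inner"
  assumes "bounded_linear B"
  shows "inner (B x) y = inner x (adjoint B y)"
proof -
  have "\<exists>w. \<forall>x. inner (B x) y = inner x w" for y
    using riesz_representation[OF bounded_linear_compose[OF bounded_linear_inner_left[of y] assms]]
    by (auto simp: o_def)
  then have "\<exists>g. \<forall>x y. inner (B x) y = inner x (g y)" by metis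
  then show ?thesis unfolding adjoint_def by (rule someI2_ex) simp
qed

lemma norm_adjoint_le:
  fixes B :: "'u::{real_inner,complete_space} \<Rightarrow> 'h::real_inner"
  assumes B: "bounded_linear B" and b: "b \<ge> 0" "\<And>x. norm (B x) \<le> b * norm x"
  shows "norm (adjoint B y) \<le> b * norm y"
proof (cases "adjoint B y = 0")
  case False
  let ?a = "adjoint B y"
  have "norm ?a * norm ?a = inner (B ?a) y"
    by (simp add: inner_adjoint[OF B] dot_square_norm power2_eq_square)
  also have "\<dots> \<le> norm (B ?a) * norm y" by (rule norm_cauchy_schwarz)
  also have "\<dots> \<le> b * norm ?a * norm y" using b(2) by (intro mult_right_mono) auto
  finally have "norm ?a * norm ?a \<le> norm ?a * (b * norm y)" by (simp add: ac_simps)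
  then show ?thesis using False by simp
qed (use b in simp)

section \<open>Strongly continuous semigroups\<close>

text \<open>Factoring out the smaller of two times leaves an increment at time 0, where right
  continuity applies; the uniform bound \<open>M\<close> carries it back. Either order of the times
  is allowed, so continuity holds from both sides.\<close>

lemma C0_semigroup_continuous_on:
  assumes T: "C0_semigroup T" and M: "M > 0" "\<And>t x. t \<ge> 0 \<Longrightarrow> norm (T t x) \<le> M * norm x"
  shows "continuous_on {0..} (\<lambda>t. T t x)"
  unfolding continuous_on_iff
proof (intro ballI allI impI)
  fix t \<epsilon> :: real assume t: "t \<in> {0..}" and \<epsilon>: "\<epsilon> > 0"
  have "((\<lambda>t. T t x) \<longlongrightarrow> x) (at_right 0)" using T by (simp add: C0_semigroup_def)
  then have "eventually (\<lambda>t. dist (T t x) x < \<epsilon> / M) (at_right 0)"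
    using \<epsilon> M(1) by (intro tendstoD) auto
  then obtain d where d: "d > 0" "\<And>r. 0 < r \<Longrightarrow> r < d \<Longrightarrow> dist (T r x) x < \<epsilon> / M"
    unfolding eventually_at_right_field by auto
  have close: "dist (T v x) (T u x) < \<epsilon>" if "0 \<le> u" "u \<le> v" "v - u < d" for u v
  proof (cases "u = v")
    case True then show ?thesis using \<epsilon> by simp
  next
    case False
    then have "T v x = T u (T (v - u) x)" "bounded_linear (T u)"
      using T that unfolding C0_semigroup_def
      by (metis add_diff_cancel_left' diff_ge_0_iff_ge le_add_diff_inverse, blast)
    then have "dist (T v x) (T u x) = norm (T u (T (v - u) x - x))"
      by (simp add: dist_norm linear_diff bounded_linear.linear)
    also have "\<dots> \<le> M * dist (T (v - u) x) x" using M(2)[OF that(1)] by (simp add: dist_norm)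
    also have "\<dots> < M * (\<epsilon> / M)"
      using d(2)[of "v - u"] False that M(1) by (intro mult_strict_left_mono) auto
    finally show ?thesis using M(1) by simp
  qed
  show "\<exists>d>0. \<forall>s\<in>{0..}. dist s t < d \<longrightarrow> dist (T s x) (T t x) < \<epsilon>"
  proof (intro exI[of _ d] conjI ballI impI d(1))
    fix s assume s: "s \<in> {0..}" "dist s t < d"
    show "dist (T s x) (T t x) < \<epsilon>"
      using close[of s t] close[of t s] s t
      by (cases "s \<le> t") (auto simp: dist_real_def dist_commute)
  qed
qed

text \<open>By Cauchy-Schwarz and contractivity the difference quotients, tested against
  \<open>x\<close>, are nonpositive; so is their limit.\<close>

lemma generates_contractions_dissipative:
  fixes A :: "'h::real_inner \<Rightarrow> 'h"
  assumes "generates_contractions D A" "x \<in> D"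
  shows "inner (A x) x \<le> 0"
proof -
  obtain T where T: "generates D A T" "\<And>t x. t \<ge> 0 \<Longrightarrow> norm (T t x) \<le> norm x"
    using assms(1) unfolding generates_contractions_def by blast
  have "((\<lambda>t. (T t x - x) /\<^sub>R t) \<longlongrightarrow> A x) (at_right 0)"
    using T(1) assms(2) unfolding generates_def by blast
  then have "((\<lambda>t. inner ((T t x - x) /\<^sub>R t) x) \<longlongrightarrow> inner (A x) x) (at_right 0)"
    by (intro tendsto_intros)
  moreover have "eventually (\<lambda>t. inner ((T t x - x) /\<^sub>R t) x \<le> 0) (at_right 0)"
    unfolding eventually_at_right_field
  proof (intro exI[of _ 1] conjI allI impI)
    fix t :: real assume t: "0 < t"
    have "inner (T t x) x \<le> norm (T t x) * norm x" by (rule norm_cauchy_schwarz)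
    also have "\<dots> \<le> norm x * norm x" using T(2)[of t x] t by (intro mult_right_mono) auto
    finally have "inner (T t x - x) x \<le> 0" by (simp add: inner_diff dot_square_norm power2_eq_square)
    then show "inner ((T t x - x) /\<^sub>R t) x \<le> 0"
      using t by (simp add: mult_nonneg_nonpos)
  qed simp
  ultimately show ?thesis by (intro tendsto_upperbound) auto
qed

text \<open>Instead of the infinite-horizon Gramian of the semigroup, the form integrates only up to a time
  \<open>\<tau>\<close> with \<open>\<parallel>T \<tau>\<parallel>\<^sup>2 \<le> 1/2\<close>: its derivative along the flow is \<open>\<parallel>T \<tau> x\<parallel>\<^sup>2 - \<parallel>x\<parallel>\<^sup>2\<close>.\<close>

lemma exp_stable_quadratic_form:
  fixes A :: "'h::real_inner \<Rightarrow> 'h"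
  assumes "generates_exp_stable D A"
  obtains Q :: "'h \<Rightarrow> 'h \<Rightarrow> real" where "bounded_bilinear Q" "\<And>x y. Q x y = Q y x"
    "\<And>x. 0 \<le> Q x x" "\<And>x. x \<in> D \<Longrightarrow> 2 * Q x (A x) \<le> - (norm x)\<^sup>2 / 2"
proof -
  obtain T C \<alpha> where T: "generates D A T" and C: "C > 0" and \<alpha>: "\<alpha> > 0"
    and decay: "\<And>x t. t \<ge> 0 \<Longrightarrow> norm (T t x) \<le> C * exp (- \<alpha> * t) * norm x"
    using assms unfolding generates_exp_stable_def by blast
  have C0: "C0_semigroup T" using T by (simp add: generates_def)
  then have bl: "bounded_linear (T t)" if "t \<ge> 0" for t using that by (simp add: C0_semigroup_def)
  have T0: "T 0 x = x" for x using C0 by (simp add: C0_semigroup_def)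
  have Tadd: "T (s + t) x = T s (T t x)" if "s \<ge> 0" "t \<ge> 0" for s t x
    using C0 that by (simp add: C0_semigroup_def)
  have TC: "norm (T t x) \<le> C * norm x" if "t \<ge> 0" for t x
  proof -
    have "norm (T t x) \<le> C * exp (- \<alpha> * t) * norm x" by (rule decay[OF that])
    also have "\<dots> \<le> C * 1 * norm x"
      using C \<alpha> that by (intro mult_right_mono mult_left_mono) (auto simp: mult_nonneg_nonneg)
    finally show ?thesis by simp
  qed
  have cont: "continuous_on {0..} (\<lambda>t. T t x)" for x
    by (rule C0_semigroup_continuous_on[OF C0 C TC])
  have cont': "continuous_on {a..b} (\<lambda>t. T t x)" if "a \<ge> 0" for a b x
    using cont by (rule continuous_on_subset) (use that in auto)
  \<comment> \<open>This choice gives \<open>exp (2 * \<alpha> * \<tau>) \<ge> 2 * C\<^sup>2\<close>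
    by the estimate \<open>exp y \<ge> 1 + y\<close>.\<close>
  define \<tau> where "\<tau> = C\<^sup>2 / \<alpha>"
  have \<tau>: "\<tau> > 0" using C \<alpha> by (simp add: \<tau>_def)
  have half: "(norm (T \<tau> x))\<^sup>2 \<le> (norm x)\<^sup>2 / 2" for x
  proof -
    have "2 * C\<^sup>2 = 2 * \<alpha> * \<tau>" using \<alpha> by (simp add: \<tau>_def)
    also have "\<dots> \<le> exp (2 * \<alpha> * \<tau>)" using exp_ge_add_one_self[of "2 * \<alpha> * \<tau>"] by linarith
    finally have *: "2 * C\<^sup>2 \<le> exp (2 * \<alpha> * \<tau>)" .
    have "(C * exp (- \<alpha> * \<tau>))\<^sup>2 = C\<^sup>2 * exp (- (2 * \<alpha> * \<tau>))"
      by (simp add: power_mult_distrib exp_double[symmetric] mult.assoc)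
    also have "\<dots> \<le> 1/2" using * by (simp add: exp_minus field_simps)
    finally have "(C * exp (- \<alpha> * \<tau>))\<^sup>2 \<le> 1/2" .
    moreover have "(norm (T \<tau> x))\<^sup>2 \<le> (C * exp (- \<alpha> * \<tau>) * norm x)\<^sup>2"
      using decay[of \<tau> x] \<tau> by (intro power_mono) auto
    ultimately show ?thesis
      using mult_right_mono[of "(C * exp (- \<alpha> * \<tau>))\<^sup>2" "1/2" "(norm x)\<^sup>2"]
      by (simp add: power_mult_distrib)
  qed
  define Q where "Q = (\<lambda>x y. integral {0..\<tau>} (\<lambda>s. inner (T s x) (T s y)))"
  have cont\<tau>: "continuous_on {0..\<tau>} (\<lambda>t. T t x)" for x by (rule cont') simp
  have int: "(\<lambda>s. inner (T s x) (T s y)) integrable_on {0..\<tau>}" for x y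
    by (intro integrable_continuous_real continuous_intros cont\<tau>)
  have bilin: "bounded_bilinear Q"
  proof
    fix a a' b b' :: 'h and r :: real
    show "Q (a + a') b = Q a b + Q a' b"
      unfolding Q_def integral_add[OF int int, symmetric]
      by (intro integral_cong) (simp add: linear_add[OF bounded_linear.linear[OF bl]] inner_add)
    show "Q a (b + b') = Q a b + Q a b'"
      unfolding Q_def integral_add[OF int int, symmetric]
      by (intro integral_cong) (simp add: linear_add[OF bounded_linear.linear[OF bl]] inner_add)
    show "Q (r *\<^sub>R a) b = r *\<^sub>R Q a b"
      unfolding Q_def integral_cmul[symmetric]
      by (intro integral_cong) (simp add: linear_cmul[OF bounded_linear.linear[OF bl]])
    show "Q a (r *\<^sub>R b) = r *\<^sub>R Q a b"
      unfolding Q_def integral_cmul[symmetric]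
      by (intro integral_cong) (simp add: linear_cmul[OF bounded_linear.linear[OF bl]])
    show "\<exists>K. \<forall>a b. norm (Q a b) \<le> norm a * norm b * K"
    proof (intro exI[of _ "C\<^sup>2 * \<tau>"] allI)
      fix a b
      have "norm (Q a b) \<le> (C * norm a) * (C * norm b) * (\<tau> - 0)"
        unfolding Q_def
      proof (intro integral_bound)
        fix t assume t: "t \<in> {0..\<tau>}"
        have "norm (inner (T t a) (T t b)) \<le> norm (T t a) * norm (T t b)"
          by (simp add: Cauchy_Schwarz_ineq2)
        also have "\<dots> \<le> (C * norm a) * (C * norm b)"
          using TC[of t] t C by (intro mult_mono) auto
        finally show "norm (inner (T t a) (T t b)) \<le> (C * norm a) * (C * norm b)" .
      qed (use \<tau> in \<open>auto intro!: continuous_intros cont\<tau>\<close>)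
      then show "norm (Q a b) \<le> norm a * norm b * (C\<^sup>2 * \<tau>)"
        by (simp add: power2_eq_square algebra_simps)
    qed
  qed
  have sym: "Q x y = Q y x" for x y by (simp add: Q_def inner_commute)
  have nonneg: "0 \<le> Q x x" for x
    unfolding Q_def by (intro integral_nonneg int) simp
  have "2 * Q x (A x) \<le> - (norm x)\<^sup>2 / 2" if x: "x \<in> D" for x
  proof -
    interpret bounded_bilinear Q by (rule bilin)
    define n where "n = (\<lambda>s. inner (T s x) (T s x))"
    have n: "continuous_on {a..b} n" if "a \<ge> 0" for a b
      unfolding n_def by (intro continuous_intros cont' that)
    define G where "G = (\<lambda>u. integral {0..u} n)"
    \<comment> \<open>The endpoint exceeds \<tau> so that the right derivative of \<open>G\<close>
      at \<tau> is available.\<close>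
    have G: "(G has_real_derivative n u) (at u within {0..\<tau> + 1})" if "u \<in> {0..\<tau> + 1}" for u
      unfolding G_def using that n by (intro integral_has_real_derivative) auto
    \<comment> \<open>By the semigroup law the form along the orbit is the integral of
      \<open>n\<close> over the moving window from \<open>s\<close> to
      \<open>s + \<tau>\<close>.\<close>
    have E: "Q (T s x) (T s x) = G (s + \<tau>) - G s" if s: "s \<ge> 0" for s
    proof -
      have "Q (T s x) (T s x) = integral {0..\<tau>} (n \<circ> (+) s)"
        unfolding Q_def n_def o_def
        by (intro integral_cong) (use s in \<open>auto simp: Tadd[symmetric] add.commute\<close>)
      also have "\<dots> = integral {0 + s..\<tau> + s} n" by (rule integral_shift_Icc_real)
      finally have "Q (T s x) (T s x) = integral {s..s + \<tau>} n" by (simp add: add.commute)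
      moreover have "integral {0..s} n + integral {s..s + \<tau>} n = integral {0..s + \<tau>} n"
        using s \<tau> by (intro Henstock_Kurzweil_Integration.integral_combine integrable_continuous_real n) auto
      ultimately show ?thesis by (simp add: G_def)
    qed
    have "((G \<circ> (\<lambda>s. s + \<tau>)) has_real_derivative n (0 + \<tau>) * 1) (at 0 within {0..1})"
    proof (rule DERIV_image_chain)
      show "(G has_real_derivative n (0 + \<tau>)) (at (0 + \<tau>) within (\<lambda>s. s + \<tau>) ` {0..1})"
        by (rule DERIV_subset[OF G]) (use \<tau> in auto)
    qed (auto intro!: derivative_eq_intros)
    moreover have "(G has_real_derivative n 0) (at 0 within {0..1})"
      by (rule DERIV_subset[OF G]) (use \<tau> in auto)
    ultimately have "((\<lambda>s. G (s + \<tau>) - G s) has_real_derivative n \<tau> - n 0) (at 0 within {0..1})"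
      by (auto intro!: derivative_eq_intros simp: o_def)
    then have "((\<lambda>s. Q (T s x) (T s x)) has_real_derivative n \<tau> - n 0) (at 0 within {0..1})"
      by (rule has_field_derivative_transform_within[where d = 1]) (auto simp: E)
    then have 1: "((\<lambda>s. (Q (T s x) (T s x) - Q x x) / s) \<longlongrightarrow> n \<tau> - n 0) (at_right 0)"
      by (simp add: has_field_derivative_iff at_within_Icc_at_right T0)
    \<comment> \<open>The right derivative is computed a second time, by expanding the quotient
      bilinearly; convergence needs \<open>x\<close> in the domain. Uniqueness of limits then
      identifies \<open>2 * Q x (A x)\<close>.\<close>
    have lim: "((\<lambda>t. (T t x - x) /\<^sub>R t) \<longlongrightarrow> A x) (at_right 0)" "((\<lambda>t. T t x) \<longlongrightarrow> x) (at_right 0)"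
      using T x C0 unfolding generates_def C0_semigroup_def by blast+
    have "((\<lambda>s. Q ((T s x - x) /\<^sub>R s) (T s x) + Q x ((T s x - x) /\<^sub>R s)) \<longlongrightarrow> Q (A x) x + Q x (A x)) (at_right 0)"
      by (intro tendsto_intros tendsto lim)
    then have 2: "((\<lambda>s. (Q (T s x) (T s x) - Q x x) / s) \<longlongrightarrow> Q (A x) x + Q x (A x)) (at_right 0)"
      by (rule Lim_transform_eventually)
         (simp add: diff_left diff_right scaleR_left scaleR_right divide_inverse algebra_simps)
    have "2 * Q x (A x) = n \<tau> - n 0"
      using tendsto_unique[OF _ 1 2] sym[of "A x" x] by simp
    then show ?thesis using half[of x] by (simp add: n_def T0 power2_norm_eq_inner)
  qed
  with bilin sym nonneg show thesis by (rule that)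
qed

subsection \<open>Strong solutions\<close>

lemma strong_solution_derivative:
  assumes "strong_solution D F z0 z"
  shows "AE t in lebesgue. t \<ge> 0 \<longrightarrow> z t \<in> D \<and> (z has_vector_derivative F (z t)) (at t within {0..})"
proof -
  have "AE t in lebesgue. t \<ge> 0 \<longrightarrow> (z has_vector_derivative F (z t)) (at t within {0..})"
    and "\<And>t. t \<ge> 0 \<Longrightarrow> z t \<in> D"
    using assms by (auto simp: strong_solution_def)
  then show ?thesis by (auto elim: AE_mp intro: AE_I2)
qed

lemma has_real_derivative_norm_power2:
  fixes y :: "real \<Rightarrow> 'h::real_inner"
  assumes "(y has_vector_derivative y') (at t within S)"
  shows "((\<lambda>\<tau>. (norm (y \<tau>))\<^sup>2) has_real_derivative 2 * inner (y t) y') (at t within S)"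
  using bounded_bilinear.has_vector_derivative[OF bounded_bilinear_inner assms assms]
  by (simp add: has_real_derivative_iff_has_vector_derivative power2_norm_eq_inner inner_commute)

lemma locally_abs_continuous_norm_power2:
  fixes y :: "real \<Rightarrow> 'h::real_inner"
  assumes "locally_abs_continuous y"
  shows "locally_abs_continuous (\<lambda>t. (norm (y t))\<^sup>2)"
  unfolding power2_norm_eq_inner
  by (rule locally_abs_continuous_bilinear[OF bounded_bilinear_inner assms assms])

text \<open>The equation is autonomous. The delayed trajectory is the second solution to which the
  contraction estimate is applied.\<close>

lemma strong_solution_shift:
  fixes F :: "'h::real_normed_vector \<Rightarrow> 'h"
  assumes "strong_solution D F z0 z" "h \<ge> 0"
  shows "strong_solution D F (z h) (\<lambda>t. z (t + h))"
  unfolding strong_solution_def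
proof (intro conjI allI impI)
  show "locally_abs_continuous (\<lambda>t. z (t + h))"
    using assms locally_abs_continuous_shift unfolding strong_solution_def by blast
  show "z (t + h) \<in> D" if "0 \<le> t" for t
    using assms that unfolding strong_solution_def by simp
  have "AE t in lebesgue. t \<ge> 0 \<longrightarrow> (z has_vector_derivative F (z t)) (at t within {0..})"
    using assms(1) unfolding strong_solution_def by blast
  from AE_lebesgue_shift[OF this, of h]
  show "AE t in lebesgue. 0 \<le> t \<longrightarrow> ((\<lambda>t. z (t + h)) has_vector_derivative F (z (t + h))) (at t within {0..})"
  proof (rule AE_mp, intro AE_I2 impI)
    fix t assume "0 \<le> t + h \<longrightarrow> (z has_vector_derivative F (z (t + h))) (at (t + h) within {0..})" "0 \<le> t"
    then have "(z has_vector_derivative F (z (t + h))) (at (t + h) within {0..})" using assms(2) by simp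
    then have "(z has_vector_derivative F (z (t + h))) (at (t + h) within (\<lambda>s. s + h) ` {0..})"
      by (rule has_vector_derivative_within_subset) (use assms(2) in auto)
    moreover have "((\<lambda>s. s + h) has_vector_derivative 1) (at t within {0..})"
      by (auto intro!: derivative_eq_intros)
    ultimately have "(z \<circ> (\<lambda>s. s + h) has_vector_derivative 1 *\<^sub>R F (z (t + h))) (at t within {0..})"
      by (intro vector_diff_chain_within)
    then show "((\<lambda>t. z (t + h)) has_vector_derivative F (z (t + h))) (at t within {0..})"
      by (simp add: o_def)
  qed
qed simp

section \<open>Contraction, speed and decay estimates\<close>

text \<open>The squared distance has derivative
  \<open>2 * inner (x t - y t) (F (x t) - F (y t))\<close> almost everywhere, which is nonpositive
  by \<open>mono\<close>.\<close>

lemma strong_solution_contraction: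
  fixes F :: "'h::real_inner \<Rightarrow> 'h"
  assumes mono: "\<And>x y. x \<in> D \<Longrightarrow> y \<in> D \<Longrightarrow> inner (F x - F y) (x - y) \<le> 0"
    and 1: "strong_solution D F x0 x" and 2: "strong_solution D F y0 y" and t: "t \<ge> 0"
  shows "norm (x t - y t) \<le> norm (x0 - y0)"
proof -
  have lac: "locally_abs_continuous x" "locally_abs_continuous y" and init: "x 0 = x0" "y 0 = y0"
    using 1 2 by (auto simp: strong_solution_def)
  have "(norm (x t - y t))\<^sup>2 \<le> (norm (x 0 - y 0))\<^sup>2"
  proof (rule AE_deriv_nonpos_imp_le[OF locally_abs_continuous_norm_power2[OF
        locally_abs_continuous_diff[OF lac]] _ order_refl t])
    show "AE t in lebesgue. t \<ge> 0 \<longrightarrow>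
        (\<exists>d\<le>0. ((\<lambda>t. (norm (x t - y t))\<^sup>2) has_real_derivative d) (at t within {0..}))"
      using strong_solution_derivative[OF 1] strong_solution_derivative[OF 2]
    proof eventually_elim
      case (elim t)
      show ?case
      proof
        assume "t \<ge> 0"
        with elim have *: "x t \<in> D" "y t \<in> D"
          "((\<lambda>t. x t - y t) has_vector_derivative F (x t) - F (y t)) (at t within {0..})"
          by (auto intro!: derivative_intros)
        have "2 * inner (x t - y t) (F (x t) - F (y t)) \<le> 0"
          using mono[OF *(1,2)] by (simp add: inner_commute)
        with has_real_derivative_norm_power2[OF *(3)]
        show "\<exists>d\<le>0. ((\<lambda>t. (norm (x t - y t))\<^sup>2) has_real_derivative d) (at t within {0..})" by blast
      qed
    qed
  qed
  then show ?thesis using init by (simp add: power2_le_iff_abs_le)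
qed

lemma strong_solution_initial_speed:
  fixes F :: "'h::real_inner \<Rightarrow> 'h"
  assumes mono: "\<And>x y. x \<in> D \<Longrightarrow> y \<in> D \<Longrightarrow> inner (F x - F y) (x - y) \<le> 0"
    and z: "strong_solution D F z0 z" and h: "h \<ge> 0"
  shows "norm (z h - z0) \<le> h * norm (F z0)"
proof (rule field_le_epsilon)
  fix \<epsilon> :: real assume \<epsilon>: "\<epsilon> > 0"
  have lac: "locally_abs_continuous z" and init: "z 0 = z0" and z0: "z0 \<in> D"
    using z by (auto simp: strong_solution_def)
  \<comment> \<open>The norm is not differentiable at 0, so a smooth regularization replaces it. As
    the norm of a pair, \<open>p\<close> inherits absolute continuity from \<open>z\<close>.\<close>
  define p where "p = (\<lambda>t. sqrt (\<epsilon>\<^sup>2 + (norm (z t - z0))\<^sup>2))"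
  have p: "p t = norm (\<epsilon>, z t - z0)" for t by (simp add: p_def norm_Pair)
  have lacp: "locally_abs_continuous p"
  proof (rule locally_abs_continuous_dominated[OF lac lac], intro exI[of _ 1] ballI)
    fix s t
    have "norm (p t - p s) \<le> norm ((\<epsilon>, z t - z0) - (\<epsilon>, z s - z0))"
      unfolding p real_norm_def by (rule norm_triangle_ineq3)
    also have "\<dots> = norm (z t - z s)" by (simp add: norm_Pair)
    finally show "norm (p t - p s) \<le> 1 * (norm (z t - z s) + norm (z t - z s))"
      using norm_ge_zero[of "z t - z s"] by argo
  qed
  have "p h - norm (F z0) * h \<le> p 0 - norm (F z0) * 0"
  proof (rule AE_deriv_nonpos_imp_le[OF locally_abs_continuous_diff[OF lacp] _ order_refl h])
    show "locally_abs_continuous (\<lambda>t. norm (F z0) * t)"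
      by (rule locally_abs_continuous_lipschitz)
         (auto intro!: exI[of _ "norm (F z0)"] simp: abs_mult right_diff_distrib[symmetric])
    show "AE t in lebesgue. t \<ge> 0 \<longrightarrow>
        (\<exists>d\<le>0. ((\<lambda>t. p t - norm (F z0) * t) has_real_derivative d) (at t within {0..}))"
      using strong_solution_derivative[OF z]
    proof eventually_elim
      case (elim t)
      show ?case
      proof
        assume "t \<ge> 0"
        with elim have zt: "z t \<in> D"
          and dz: "((\<lambda>t. z t - z0) has_vector_derivative F (z t)) (at t within {0..})"
          by (auto intro!: derivative_eq_intros)
        have pos: "\<epsilon>\<^sup>2 + (norm (z t - z0))\<^sup>2 > 0" using \<epsilon> by (simp add: add_pos_nonneg)
        then have pt: "p t > 0" by (simp add: p_def)
        have dp: "(p has_real_derivative inner (z t - z0) (F (z t)) / p t) (at t within {0..})"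
          using DERIV_chain2[OF DERIV_real_sqrt[OF pos]
              DERIV_add[OF DERIV_const has_real_derivative_norm_power2[OF dz]]]
          unfolding p_def by (simp add: field_simps)
        have "inner (z t - z0) (F (z t)) \<le> inner (z t - z0) (F z0)"
          using mono[OF zt z0] by (simp add: inner_diff inner_commute)
        also have "\<dots> \<le> norm (z t - z0) * norm (F z0)" by (rule norm_cauchy_schwarz)
        also have "\<dots> \<le> p t * norm (F z0)"
          unfolding p_def by (intro mult_right_mono real_le_rsqrt) auto
        finally have "inner (z t - z0) (F (z t)) / p t - norm (F z0) \<le> 0"
          using pt by (simp add: field_simps)
        moreover have "((\<lambda>t. p t - norm (F z0) * t) has_real_derivative
            inner (z t - z0) (F (z t)) / p t - norm (F z0)) (at t within {0..})"
          by (auto intro!: derivative_eq_intros dp)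
        ultimately show "\<exists>d\<le>0. ((\<lambda>t. p t - norm (F z0) * t) has_real_derivative d) (at t within {0..})"
          by blast
      qed
    qed
  qed
  moreover have "p 0 = \<epsilon>" using \<epsilon> init by (simp add: p_def)
  moreover have "norm (z h - z0) \<le> p h" unfolding p_def by (rule real_le_rsqrt) simp
  ultimately show "norm (z h - z0) \<le> h * norm (F z0) + \<epsilon>" by (simp add: mult.commute)
qed

lemma norm_derivative_le:
  assumes d: "(z has_vector_derivative v) (at t within {0..})" and t: "t \<ge> 0"
    and le: "\<And>h. h > 0 \<Longrightarrow> norm (z (t + h) - z t) \<le> h * c"
  shows "norm v \<le> c"
proof (rule field_le_epsilon)
  fix e :: real assume e: "e > 0"
  have "(z has_derivative (\<lambda>x. x *\<^sub>R v)) (at t within {0..})"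
    using d by (simp add: has_vector_derivative_def)
  then obtain r where r: "r > 0"
    "\<forall>y\<in>{0..}. norm (y - t) < r \<longrightarrow> norm (z y - z t - (y - t) *\<^sub>R v) \<le> e * norm (y - t)"
    unfolding has_derivative_within_alt using e by blast
  define h where "h = r / 2"
  have h: "h > 0" "h < r" using r by (auto simp: h_def)
  have "norm (z (t + h) - z t - h *\<^sub>R v) \<le> e * h"
    using bspec[OF r(2), of "t + h"] h t by auto
  then have "norm (h *\<^sub>R v) \<le> h * c + e * h"
    using le[OF h(1)] norm_triangle_ineq3[of "z (t + h) - z t" "h *\<^sub>R v"] by linarith
  then have "h * norm v \<le> h * (c + e)" using h by (simp add: algebra_simps)
  then show "norm v \<le> c + e" using h by simp
qed

text \<open>The distance between the solution and its shift by \<open>h\<close> is at most its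
  initial value, which is at most \<open>h * norm (F z0)\<close>. Dividing by \<open>h\<close>
  bounds the derivative.\<close>

lemma strong_solution_speed:
  fixes F :: "'h::real_inner \<Rightarrow> 'h"
  assumes mono: "\<And>x y. x \<in> D \<Longrightarrow> y \<in> D \<Longrightarrow> inner (F x - F y) (x - y) \<le> 0"
    and z: "strong_solution D F z0 z"
  shows "AE t in lebesgue. t \<ge> 0 \<longrightarrow> norm (F (z t)) \<le> norm (F z0)"
  using strong_solution_derivative[OF z]
proof eventually_elim
  case (elim t)
  show ?case
  proof
    assume t: "t \<ge> 0"
    show "norm (F (z t)) \<le> norm (F z0)"
    proof (rule norm_derivative_le[OF _ t])
      show "(z has_vector_derivative F (z t)) (at t within {0..})" using elim t by blast
      fix h :: real assume h: "h > 0"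
      have "norm (z (t + h) - z t) \<le> norm (z h - z0)"
        using strong_solution_contraction[OF mono strong_solution_shift[OF z, of h] z t] h by simp
      also have "\<dots> \<le> h * norm (F z0)"
        by (rule strong_solution_initial_speed[OF mono z]) (use h in auto)
      finally show "norm (z (t + h) - z t) \<le> h * norm (F z0)" .
    qed
  qed
qed

text \<open>A Gronwall argument: the weight \<open>exp (c * t)\<close> turns the hypothesis into a
  nonpositive derivative. The sign of \<open>c\<close> is free, hence the absolute values in the
  Lipschitz bound of the weight.\<close>

lemma AE_deriv_le_imp_exp_decay:
  fixes V :: "real \<Rightarrow> real"
  assumes lac: "locally_abs_continuous V" and t: "t \<ge> 0"
    and ae: "AE t in lebesgue. t \<ge> 0 \<longrightarrow> (\<exists>d\<le>- c * V t. (V has_real_derivative d) (at t within {0..}))"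
  shows "V t \<le> exp (- c * t) * V 0"
proof -
  have lacexp: "locally_abs_continuous (\<lambda>t. exp (c * t))"
  proof (rule locally_abs_continuous_lipschitz)
    fix T :: real assume "T > 0"
    have "norm (exp (c * t) - exp (c * s)) \<le> (\<bar>c\<bar> * exp (\<bar>c\<bar> * T)) * norm (t - s)"
      if "s \<in> {0..T}" "t \<in> {0..T}" for s t
    proof (rule field_differentiable_bound[where S = "{0..T}" and f' = "\<lambda>t. c * exp (c * t)"])
      show "((\<lambda>t. exp (c * t)) has_real_derivative c * exp (c * u)) (at u within {0..T})" for u
        by (auto intro!: derivative_eq_intros)
      show "norm (c * exp (c * u)) \<le> \<bar>c\<bar> * exp (\<bar>c\<bar> * T)" if "u \<in> {0..T}" for u
      proof -
        have "c * u \<le> \<bar>c\<bar> * T" using that by (intro mult_mono) auto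
        then show ?thesis by (simp add: abs_mult mult_left_mono)
      qed
    qed (use that in auto)
    then show "\<exists>L. \<forall>s\<in>{0..T}. \<forall>t\<in>{0..T}. norm (exp (c * t) - exp (c * s)) \<le> L * \<bar>t - s\<bar>"
      by (metis real_norm_def)
  qed
  have "exp (c * t) * V t \<le> exp (c * 0) * V 0"
  proof (rule AE_deriv_nonpos_imp_le[OF
        locally_abs_continuous_bilinear[OF bounded_bilinear_mult lacexp lac] _ order_refl t])
    show "AE t in lebesgue. t \<ge> 0 \<longrightarrow>
        (\<exists>d\<le>0. ((\<lambda>t. exp (c * t) * V t) has_real_derivative d) (at t within {0..}))"
      using ae
    proof eventually_elim
      case (elim t)
      show ?case
      proof
        assume "t \<ge> 0"
        with elim obtain d where d: "d \<le> - c * V t" "(V has_real_derivative d) (at t within {0..})" by blast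
        have "((\<lambda>t. exp (c * t) * V t) has_real_derivative exp (c * t) * (c * V t + d)) (at t within {0..})"
          by (auto intro!: derivative_eq_intros d(2) simp: algebra_simps)
        moreover have "exp (c * t) * (c * V t + d) \<le> 0"
          using d(1) by (intro mult_nonneg_nonpos) auto
        ultimately show "\<exists>d\<le>0. ((\<lambda>t. exp (c * t) * V t) has_real_derivative d) (at t within {0..})" by blast
      qed
    qed
  qed
  then show ?thesis by (simp add: exp_minus field_simps)
qed

subsection \<open>The damped system\<close>

lemma inner_le_dual_norm:
  assumes "bounded_linear J"
  shows "inner (J s) v \<le> dual_norm J v * norm s"
proof -
  have "bounded_linear (\<lambda>s. inner (J s) v)"
    using bounded_linear_compose[OF bounded_linear_inner_left[of v] assms] by (simp add: o_def)
  from onorm[OF this, of s] show ?thesis by (simp add: dual_norm_def)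
qed

lemma dual_norm_nonneg:
  assumes "bounded_linear J"
  shows "0 \<le> dual_norm J v"
proof -
  have "bounded_linear (\<lambda>s. inner (J s) v)"
    using bounded_linear_compose[OF bounded_linear_inner_left[of v] assms] by (simp add: o_def)
  then show ?thesis unfolding dual_norm_def by (rule onorm_pos_le)
qed

text \<open>The functional is tested on the preimage of \<open>v\<close> itself, which has the same
  norm as \<open>v\<close>.\<close>

lemma norm_le_dual_norm:
  assumes "bounded_linear J" "trivial_rigging J"
  shows "norm v \<le> dual_norm J v"
proof (cases "v = 0")
  case True
  then show ?thesis using dual_norm_nonneg[OF assms(1)] by simp
next
  case False
  obtain s where s: "J s = v" using assms(2) unfolding trivial_rigging_def by (metis surjD)
  have "norm s = norm v" using assms(2) s unfolding trivial_rigging_def by metis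
  then have "norm v * norm v \<le> dual_norm J v * norm v"
    using inner_le_dual_norm[OF assms(1), of s v] s by (simp add: dot_square_norm power2_eq_square)
  then show ?thesis using False by simp
qed

lemma orthogonal_range_dense_imp_0:
  fixes J :: "'s \<Rightarrow> 'u::real_inner"
  assumes "closure (range J) = UNIV" "\<And>s. inner (J s) v = 0"
  shows "v = 0"
proof -
  have "closed {x. inner x v = 0}" by (intro closed_Collect_eq continuous_intros)
  then have "closure (range J) \<subseteq> {x. inner x v = 0}"
    using assms(2) by (intro closure_minimal) auto
  then have "inner v v = 0" using assms(1) by blast
  then show ?thesis by simp
qed

section \<open>Consequences of D3 and the abstract closed loop\<close>

text \<open>The witnesses of \<open>D3\<close> are parameters because the weights of both Lyapunov
  arguments are built from them.\<close>

locale D3_damping =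
  fixes J :: "'s::banach \<Rightarrow> 'u::{real_inner,complete_space}" and \<sigma> :: "'u \<Rightarrow> 's"
    and C1 C2 :: real and h :: "real \<Rightarrow> real"
  assumes J: "bounded_linear J"
    and C1: "C1 > 0" and C2: "C2 > 0"
    and h_cont: "continuous_on UNIV h" and h_mono: "mono h" and h_nonneg: "h x \<ge> 0" and h_0: "h 0 > 0"
    and D3: "dual_norm J (J (\<sigma> (J s)) - C1 *\<^sub>R J s) \<le> C2 * h (norm s) * inner (J (\<sigma> (J s))) (J s)"
begin

text \<open>The left side of \<open>D3\<close> is a norm and
  \<open>h (norm s) \<ge> h 0 > 0\<close>, so \<open>D3\<close> forces the sign.\<close>

lemma inner_damping_nonneg: "0 \<le> inner (J (\<sigma> (J s))) (J s)"
proof -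
  have "h (norm s) > 0" using h_0 h_mono by (metis less_le_trans monoD norm_ge_zero)
  moreover have "0 \<le> C2 * h (norm s) * inner (J (\<sigma> (J s))) (J s)"
    using D3[of s] dual_norm_nonneg[OF J] by (rule order_trans[rotated])
  ultimately show ?thesis using C2 by (meson mult_pos_neg mult_pos_pos not_le)
qed

text \<open>Pairing the difference in \<open>D3\<close> with \<open>- s\<close> bounds
  \<open>C1 * (norm (J s))\<^sup>2\<close> by the damping term plus a dual norm times
  \<open>norm s\<close>; \<open>D3\<close> bounds the latter by the damping term again.\<close>

lemma norm_power2_le_inner_damping:
  assumes "norm s \<le> \<rho>"
  shows "(norm (J s))\<^sup>2 \<le> (1 + C2 * h \<rho> * \<rho>) / C1 * inner (J (\<sigma> (J s))) (J s)"
proof -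
  let ?e = "inner (J (\<sigma> (J s))) (J s)"
  have \<rho>: "0 \<le> \<rho>" using assms norm_ge_zero order_trans by blast
  have "C1 * (norm (J s))\<^sup>2 - ?e = inner (J (- s)) (J (\<sigma> (J s)) - C1 *\<^sub>R J s)"
    using linear_neg[OF bounded_linear.linear[OF J], of s]
    by (simp add: inner_diff inner_commute power2_norm_eq_inner)
  also have "\<dots> \<le> dual_norm J (J (\<sigma> (J s)) - C1 *\<^sub>R J s) * norm s"
    using inner_le_dual_norm[OF J, of "- s"] by simp
  also have "\<dots> \<le> C2 * h (norm s) * ?e * norm s"
    by (intro mult_right_mono D3) simp
  also have "\<dots> \<le> C2 * h \<rho> * ?e * \<rho>"
    using assms \<rho> C2 h_nonneg inner_damping_nonneg monoD[OF h_mono assms]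
    by (intro mult_mono mult_nonneg_nonneg) auto
  finally have "C1 * (norm (J s))\<^sup>2 \<le> (1 + C2 * h \<rho> * \<rho>) * ?e" by (simp add: algebra_simps)
  then show ?thesis using C1 by (simp add: field_simps)
qed

text \<open>At \<open>s = 0\<close> the right side of \<open>D3\<close> vanishes, so
  \<open>J (\<sigma> 0)\<close> is orthogonal to the dense range of \<open>J\<close>.\<close>

lemma damping_0:
  assumes "closure (range J) = UNIV"
  shows "J (\<sigma> 0) = 0"
proof (rule orthogonal_range_dense_imp_0[OF assms])
  have J0: "J 0 = 0" using J by (simp add: linear_0 bounded_linear.linear)
  have dn: "dual_norm J (J (\<sigma> 0)) \<le> 0" using D3[of 0] J0 by simp
  have le: "inner (J s) (J (\<sigma> 0)) \<le> 0" for s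
    using inner_le_dual_norm[OF J, of s "J (\<sigma> 0)"] dn
    by (meson mult_nonpos_nonneg norm_ge_zero order_trans)
  show "inner (J s) (J (\<sigma> 0)) = 0" for s
    using le[of s] le[of "- s"] linear_neg[OF bounded_linear.linear[OF J], of s] by simp
qed

end

text \<open>No semigroup appears here: the generator enters through dissipativity, the stable linear
  system through the decrease of \<open>Q\<close>. The constant \<open>b\<close> bounds
  \<open>B\<close> together with its factor \<open>sqrt k\<close>, so that it also bounds
  \<open>w\<close>.\<close>

locale damped_system = D3_damping J \<sigma> C1 C2 h
  for J :: "'s::banach \<Rightarrow> 'u::{real_inner,complete_space}" and \<sigma> :: "'u \<Rightarrow> 's" and C1 C2 h +
  fixes D :: "'h::{real_inner,complete_space} set" and A :: "'h \<Rightarrow> 'h" and B :: "'u \<Rightarrow> 'h" and k :: real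
    and Q :: "'h \<Rightarrow> 'h \<Rightarrow> real" and q b :: real
  assumes A: "densely_defined_linear D A" and dissipative: "x \<in> D \<Longrightarrow> inner (A x) x \<le> 0"
    and B: "bounded_linear B" and k: "k > 0"
    and b: "b \<ge> 0" "norm (sqrt k *\<^sub>R B u) \<le> b * norm u"
    and Q: "bounded_bilinear Q" "Q x y = Q y x" "0 \<le> Q x x"
    and q: "q \<ge> 0" "\<bar>Q x y\<bar> \<le> q * norm x * norm y"
    and Q_decrease: "x \<in> D \<Longrightarrow> 2 * Q x (A x - k *\<^sub>R B (adjoint B x)) \<le> - (norm x)\<^sup>2 / 2"
begin

abbreviation F :: "'h \<Rightarrow> 'h" where "F \<equiv> A_sigma A B k J \<sigma>"

definition w :: "'h \<Rightarrow> 'u" where "w z = sqrt k *\<^sub>R adjoint B z"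

definition dissipation :: "'h \<Rightarrow> real" where "dissipation z = inner (J (\<sigma> (w z))) (w z)"

lemma F_eq: "F z = A z - sqrt k *\<^sub>R B (J (\<sigma> (w z)))"
  by (simp add: A_sigma_def w_def)

lemma inner_B: "inner (sqrt k *\<^sub>R B u) z = inner u (w z)"
  by (simp add: w_def inner_adjoint[OF B])

lemma norm_w_le: "norm (w z) \<le> b * norm z"
proof -
  have "norm (B u) \<le> b / sqrt k * norm u" for u
    using b(2)[of u] k by (simp add: field_simps)
  then have "norm (adjoint B z) \<le> b / sqrt k * norm z"
    using b(1) k by (intro norm_adjoint_le[OF B]) auto
  then show ?thesis using k by (simp add: w_def field_simps)
qed

lemma energy_decrease: "z \<in> D \<Longrightarrow> inner z (F z) \<le> - dissipation z"
  using dissipative[of z] inner_B[of "J (\<sigma> (w z))" z]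
  by (simp add: F_eq dissipation_def inner_diff inner_commute)

text \<open>\<open>F\<close> is the linear closed loop plus \<open>sqrt k *\<^sub>R B\<close>
  applied to \<open>w z - J (\<sigma> (w z))\<close>. The part of this error linear in
  \<open>norm (w z)\<close> is absorbed by Young's inequality, at the price of half of the decay.
  The two cases differ in \<open>a\<close> and \<open>\<beta>\<close>:
  \<open>\<bar>1 - C1\<bar>\<close> with a weight from \<open>D3\<close>, or \<open>1 + L\<close>
  with 0.\<close>

lemma Q_decrease_nonlinear:
  assumes z: "z \<in> D"
    and diff: "norm (w z - J (\<sigma> (w z))) \<le> a * norm (w z) + \<beta> * dissipation z"
    and w: "(norm (w z))\<^sup>2 \<le> \<gamma> * dissipation z"
  shows "2 * Q z (F z) \<le> - (norm z)\<^sup>2 / 4 + (4 * (q * b * a)\<^sup>2 * \<gamma> + 2 * q * b * \<beta> * norm z) * dissipation z"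
proof -
  interpret bounded_bilinear Q by (rule Q(1))
  let ?v = "J (\<sigma> (w z))"
  have "k *\<^sub>R B (adjoint B z) = sqrt k *\<^sub>R B (w z)"
    using k by (simp add: w_def linear_cmul[OF bounded_linear.linear[OF B]])
  then have "F z = (A z - k *\<^sub>R B (adjoint B z)) + sqrt k *\<^sub>R B (w z - ?v)"
    by (simp add: F_eq linear_diff[OF bounded_linear.linear[OF B]] algebra_simps)
  then have "2 * Q z (F z) = 2 * Q z (A z - k *\<^sub>R B (adjoint B z)) + 2 * Q z (sqrt k *\<^sub>R B (w z - ?v))"
    by (simp add: add_right)
  also have "\<dots> \<le> - (norm z)\<^sup>2 / 2 + 2 * (q * norm z * norm (sqrt k *\<^sub>R B (w z - ?v)))"
    using Q_decrease[OF z] q(2)[of z "sqrt k *\<^sub>R B (w z - ?v)"] by linarith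
  also have "\<dots> \<le> - (norm z)\<^sup>2 / 2 + 2 * (q * norm z * (b * (a * norm (w z) + \<beta> * dissipation z)))"
  proof -
    have "norm (sqrt k *\<^sub>R B (w z - ?v)) \<le> b * (a * norm (w z) + \<beta> * dissipation z)"
      using b diff by (meson mult_left_mono order_trans)
    then show ?thesis using q(1) by (intro add_left_mono mult_left_mono) auto
  qed
  also have "\<dots> \<le> - (norm z)\<^sup>2 / 4 + 4 * (q * b * a)\<^sup>2 * (norm (w z))\<^sup>2
      + 2 * q * b * \<beta> * norm z * dissipation z"
  proof -
    \<comment> \<open>Young's inequality, weighted so that exactly a quarter of the squared norm is
      spent.\<close>
    have "0 \<le> (norm z / 2 - 2 * (q * b * a) * norm (w z))\<^sup>2" by simp
    then show ?thesis by (simp add: power2_diff power_mult_distrib algebra_simps power2_eq_square)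
  qed
  also have "\<dots> \<le> - (norm z)\<^sup>2 / 4 + 4 * (q * b * a)\<^sup>2 * (\<gamma> * dissipation z)
      + 2 * q * b * \<beta> * norm z * dissipation z"
    using w by (intro add_right_mono add_left_mono mult_left_mono) auto
  finally show ?thesis by (simp add: algebra_simps)
qed

lemma has_real_derivative_Q:
  assumes "(z has_vector_derivative z') (at t within S)"
  shows "((\<lambda>\<tau>. Q (z \<tau>) (z \<tau>)) has_real_derivative 2 * Q (z t) z') (at t within S)"
  using bounded_bilinear.has_vector_derivative[OF Q(1) assms assms] Q(2)[of z' "z t"]
  by (simp add: has_real_derivative_iff_has_vector_derivative)

end

section \<open>The Lyapunov function when \<open>S = U\<close>\<close>

lemma antiderivative_on_nonneg:
  fixes g :: "real \<Rightarrow> real"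
  assumes g: "continuous_on UNIV g"
  obtains \<phi> where "\<phi> 0 = 0" "\<And>x. x \<ge> 0 \<Longrightarrow> (\<phi> has_real_derivative g x) (at x)"
proof -
  \<comment> \<open>Integrating from -1 makes every nonnegative point interior, so that the
    derivative at 0 is two-sided too.\<close>
  let ?\<phi> = "\<lambda>x. integral {-1..x} g - integral {-1..0} g"
  have "(?\<phi> has_real_derivative g x) (at x)" if x: "x \<ge> 0" for x
  proof -
    have "((\<lambda>x. integral {-1..x} g) has_real_derivative g x) (at x within {-1..x + 1})"
      using x g by (intro integral_has_real_derivative) (auto intro: continuous_on_subset)
    moreover have "at x within {-1..x + 1} = at x"
      using x by (intro at_within_interior) auto
    ultimately show ?thesis
      by (auto intro!: derivative_eq_intros)
  qed
  then show thesis by (intro that[of ?\<phi>]) simp_all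
qed

context damped_system
begin

lemma lyapunov_trivial_rigging:
  assumes triv: "trivial_rigging J"
  shows "\<exists>V. strict_global_lyapunov D F V"
proof -
  \<comment> \<open>The variable \<open>r\<close> stands for \<open>norm z\<close>, and
    \<open>b * r\<close> bounds the norm of \<open>w z\<close>.\<close>
  define \<gamma> where "\<gamma> = (\<lambda>r. (1 + C2 * h (b * r) * (b * r)) / C1)"
  define \<beta> where "\<beta> = (\<lambda>r. C2 * h (b * r))"
  define G where "G = (\<lambda>r. 4 * (q * b * \<bar>1 - C1\<bar>)\<^sup>2 * \<gamma> r + 2 * q * b * \<beta> r * r)"
  \<comment> \<open>\<open>g\<close> is the derivative of \<phi>. Since the squared norm decreases
    at least at twice the dissipation, \<open>G / 2\<close> is what compensates the error in
    \<open>form\<close>; the summand 1 makes \<open>\<phi> x \<ge> x\<close> and hence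
    \<open>V\<close> coercive.\<close>
  define g where "g = (\<lambda>s. 1 + G (sqrt s) / 2)"
  have diss_nonneg: "0 \<le> dissipation z"
    and form: "2 * Q z (F z) \<le> - (norm z)\<^sup>2 / 4 + G (norm z) * dissipation z" if "z \<in> D" for z
  proof -
    obtain s where s: "J s = w z" using triv unfolding trivial_rigging_def by (metis surjD)
    have "norm s = norm (w z)" using triv s unfolding trivial_rigging_def by metis
    then have ns: "norm s \<le> b * norm z" using norm_w_le by simp
    show pos: "0 \<le> dissipation z"
      using inner_damping_nonneg[of s] by (simp add: s dissipation_def)
    have w2: "(norm (w z))\<^sup>2 \<le> \<gamma> (norm z) * dissipation z"
      using norm_power2_le_inner_damping[OF ns] by (simp add: s dissipation_def \<gamma>_def)
    \<comment> \<open>Here the dual norm dominates the norm of \<open>U\<close>, so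
      \<open>D3\<close> controls all of the error except the linear part with factor
      \<open>1 - C1\<close>.\<close>
    have "norm (J (\<sigma> (w z)) - C1 *\<^sub>R w z) \<le> C2 * h (norm s) * dissipation z"
      using norm_le_dual_norm[OF J triv, of "J (\<sigma> (w z)) - C1 *\<^sub>R w z"] D3[of s]
      by (simp add: s dissipation_def)
    also have "\<dots> \<le> \<beta> (norm z) * dissipation z"
      using C2 monoD[OF h_mono ns] pos unfolding \<beta>_def by (intro mult_right_mono mult_left_mono) auto
    finally have "norm (J (\<sigma> (w z)) - C1 *\<^sub>R w z) \<le> \<beta> (norm z) * dissipation z" .
    moreover have "norm (w z - J (\<sigma> (w z))) \<le> \<bar>1 - C1\<bar> * norm (w z) + norm (J (\<sigma> (w z)) - C1 *\<^sub>R w z)"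
    proof -
      have "w z - J (\<sigma> (w z)) = (1 - C1) *\<^sub>R w z - (J (\<sigma> (w z)) - C1 *\<^sub>R w z)"
        by (simp add: scaleR_diff_left)
      then show ?thesis by (metis norm_scaleR norm_triangle_ineq4)
    qed
    ultimately have "norm (w z - J (\<sigma> (w z))) \<le> \<bar>1 - C1\<bar> * norm (w z) + \<beta> (norm z) * dissipation z"
      by linarith
    from Q_decrease_nonlinear[OF that this w2]
    show "2 * Q z (F z) \<le> - (norm z)\<^sup>2 / 4 + G (norm z) * dissipation z" unfolding G_def .
  qed
  have h_cont': "continuous_on UNIV (\<lambda>r. h (b * r))"
    by (rule continuous_on_compose2[OF h_cont]) (auto intro!: continuous_intros)
  have "continuous_on UNIV G"
    unfolding G_def \<gamma>_def \<beta>_def using C1 by (auto intro!: continuous_intros h_cont')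
  then have "continuous_on UNIV g"
    unfolding g_def by (intro continuous_intros continuous_on_compose2[of UNIV G UNIV sqrt]) auto
  then obtain \<phi> where \<phi>0: "\<phi> 0 = 0"
    and \<phi>: "\<And>x. x \<ge> 0 \<Longrightarrow> (\<phi> has_real_derivative g x) (at x)"
    using antiderivative_on_nonneg by blast
  have G_nonneg: "G r \<ge> 0" if "r \<ge> 0" for r
    unfolding G_def \<gamma>_def \<beta>_def using that b(1) q(1) C1 C2 h_nonneg
    by (intro add_nonneg_nonneg mult_nonneg_nonneg divide_nonneg_nonneg) auto
  have \<phi>_ge: "\<phi> x \<ge> x" if "x \<ge> 0" for x
  proof -
    have "\<phi> 0 - 0 \<le> \<phi> x - x"
    proof (rule DERIV_nonneg_imp_nondecreasing[OF that])
      fix y assume "0 \<le> y" "y \<le> x"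
      then have "((\<lambda>x. \<phi> x - x) has_real_derivative g y - 1) (at y)" "g y - 1 \<ge> 0"
        using \<phi> G_nonneg[of "sqrt y"] by (auto intro!: derivative_eq_intros simp: g_def)
      then show "\<exists>d. ((\<lambda>x. \<phi> x - x) has_real_derivative d) (at y) \<and> 0 \<le> d" by blast
    qed
    then show ?thesis using \<phi>0 by simp
  qed
  define V where "V = (\<lambda>x. Q x x + \<phi> ((norm x)\<^sup>2))"
  have "continuous_on {0..} \<phi>"
    using \<phi> by (intro continuous_at_imp_continuous_on) (auto intro: DERIV_isCont)
  then have contV: "continuous_on UNIV V"
    unfolding V_def
    by (intro continuous_intros bounded_bilinear.continuous_on[OF Q(1)]
        continuous_on_compose2[of "{0..}" \<phi> UNIV "\<lambda>x. (norm x)\<^sup>2"]) auto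
  have V_ge: "V x \<ge> 1 * (norm x)\<^sup>2" for x
    using Q(3)[of x] \<phi>_ge[of "(norm x)\<^sup>2"] by (simp add: V_def)
  have "AE t in lebesgue. t \<ge> 0 \<longrightarrow>
      (\<exists>d. ((\<lambda>\<tau>. V (z \<tau>)) has_real_derivative d) (at t within {0..}) \<and> d \<le> - (1/4) * (norm (z t))\<^sup>2)"
    if z: "strong_solution D F z0 z" for z0 z
    using strong_solution_derivative[OF z]
  proof eventually_elim
    case (elim t)
    show ?case
    proof
      assume "t \<ge> 0"
      with elim have zt: "z t \<in> D" and dz: "(z has_vector_derivative F (z t)) (at t within {0..})" by auto
      have dV: "((\<lambda>\<tau>. V (z \<tau>)) has_real_derivative
          2 * Q (z t) (F (z t)) + g ((norm (z t))\<^sup>2) * (2 * inner (z t) (F (z t)))) (at t within {0..})"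
        unfolding V_def
        by (intro DERIV_add has_real_derivative_Q[OF dz] DERIV_chain2[OF \<phi> has_real_derivative_norm_power2[OF dz]]) simp
      have "g ((norm (z t))\<^sup>2) = 1 + G (norm (z t)) / 2" by (simp add: g_def)
      moreover have "inner (z t) (F (z t)) \<le> - dissipation (z t)" by (rule energy_decrease[OF zt])
      moreover have "1 + G (norm (z t)) / 2 \<ge> 0" using G_nonneg[of "norm (z t)"] by simp
      ultimately have "g ((norm (z t))\<^sup>2) * (2 * inner (z t) (F (z t)))
          \<le> (1 + G (norm (z t)) / 2) * (2 * (- dissipation (z t)))"
        by (metis mult_left_mono zero_le_numeral)
      \<comment> \<open>The first term cancels the one in \<open>form\<close>; the second is
        nonpositive.\<close>
      also have "\<dots> = - G (norm (z t)) * dissipation (z t) - 2 * dissipation (z t)"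
        by (simp add: algebra_simps)
      finally have "2 * Q (z t) (F (z t)) + g ((norm (z t))\<^sup>2) * (2 * inner (z t) (F (z t)))
          \<le> - (1/4) * (norm (z t))\<^sup>2"
        using form[OF zt] diss_nonneg[OF zt] by simp
      with dV show "\<exists>d. ((\<lambda>\<tau>. V (z \<tau>)) has_real_derivative d) (at t within {0..}) \<and>
          d \<le> - (1/4) * (norm (z t))\<^sup>2" by blast
    qed
  qed
  moreover have "V x \<ge> 0" for x using V_ge[of x] by (rule order_trans[rotated]) simp
  moreover have "V 0 = 0"
    using \<phi>0 bounded_bilinear.zero_left[OF Q(1)] by (simp add: V_def)
  ultimately show ?thesis
    unfolding strict_global_lyapunov_def using contV V_ge
    by (intro exI[of _ V] conjI allI impI exI[of _ "1::real"] exI[of _ "1/4::real"]) auto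
qed

section \<open>Semi-global exponential stability when \<open>S \<noteq> U\<close>\<close>

text \<open>Linearity turns dissipativity of \<open>A\<close> into monotonicity of
  \<open>- A\<close>; for the feedback, moving \<open>B\<close> across the inner product gives
  exactly the expression in \<open>D2\<close>.\<close>

lemma F_monotone:
  assumes D2: "D2 J \<sigma>" and xy: "x \<in> D" "y \<in> D"
  shows "inner (F x - F y) (x - y) \<le> 0"
proof -
  have sub: "subspace D" using A by (simp add: densely_defined_linear_def)
  then have "x - y \<in> D" "- y \<in> D" using xy by (auto intro: subspace_diff subspace_neg)
  moreover have "A (x - y) = A x - A y"
  proof -
    have "A (x + - y) = A x + A (- y)" "A ((-1) *\<^sub>R y) = (-1) *\<^sub>R A y"
      using A xy \<open>- y \<in> D\<close> unfolding densely_defined_linear_def by blast+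
    then show ?thesis by simp
  qed
  ultimately have 1: "inner (A x - A y) (x - y) \<le> 0" using dissipative by metis
  let ?v = "J (\<sigma> (w x)) - J (\<sigma> (w y))"
  have "inner (sqrt k *\<^sub>R B (J (\<sigma> (w x))) - sqrt k *\<^sub>R B (J (\<sigma> (w y)))) (x - y)
      = inner (sqrt k *\<^sub>R B ?v) (x - y)"
    by (simp add: linear_diff[OF bounded_linear.linear[OF B]] scaleR_diff_right)
  also have "\<dots> = inner ?v (w x - w y)" by (simp only: inner_diff_right inner_B)
  also have "\<dots> \<ge> 0" using D2 by (simp add: D2_def)
  finally have 2: "inner (sqrt k *\<^sub>R B (J (\<sigma> (w x))) - sqrt k *\<^sub>R B (J (\<sigma> (w y)))) (x - y) \<ge> 0" .
  have "inner (F x - F y) (x - y) = inner (A x - A y) (x - y)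
      - inner (sqrt k *\<^sub>R B (J (\<sigma> (w x))) - sqrt k *\<^sub>R B (J (\<sigma> (w y)))) (x - y)"
    unfolding F_eq by (simp add: inner_diff_left)
  with 1 2 show ?thesis by linarith
qed

text \<open>\<open>D3\<close> concerns points in the range of \<open>J\<close>; here
  \<open>w z\<close> is the image of \<open>sqrt k *\<^sub>R s\<close>. The next lemma rests on the
  same preimage.\<close>

lemma dissipation_nonneg:
  assumes "J s = adjoint B z"
  shows "0 \<le> dissipation z"
  using inner_damping_nonneg[of "sqrt k *\<^sub>R s"] linear_cmul[OF bounded_linear.linear[OF J], of "sqrt k" s] assms
  by (simp add: dissipation_def w_def)

lemma norm_w_power2_le_dissipation:
  assumes "J s = adjoint B z" "sqrt k * norm s \<le> \<rho>"
  shows "(norm (w z))\<^sup>2 \<le> (1 + C2 * h \<rho> * \<rho>) / C1 * dissipation z"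
  using norm_power2_le_inner_damping[of "sqrt k *\<^sub>R s" \<rho>]
    linear_cmul[OF bounded_linear.linear[OF J], of "sqrt k" s] assms k
  by (simp add: dissipation_def w_def)

lemma strong_solution_norm_le:
  assumes z: "strong_solution D F z0 z" and t: "t \<ge> 0"
    and range: "\<And>x. x \<in> D \<Longrightarrow> adjoint B x \<in> range J"
  shows "norm (z t) \<le> norm z0"
proof -
  have lac: "locally_abs_continuous z" and init: "z 0 = z0"
    using z by (auto simp: strong_solution_def)
  have "(norm (z t))\<^sup>2 \<le> (norm (z 0))\<^sup>2"
  proof (rule AE_deriv_nonpos_imp_le[OF locally_abs_continuous_norm_power2[OF lac] _ order_refl t])
    show "AE t in lebesgue. t \<ge> 0 \<longrightarrow>
        (\<exists>d\<le>0. ((\<lambda>t. (norm (z t))\<^sup>2) has_real_derivative d) (at t within {0..}))"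
      using strong_solution_derivative[OF z]
    proof eventually_elim
      case (elim t)
      show ?case
      proof
        assume "t \<ge> 0"
        with elim have zt: "z t \<in> D" and dz: "(z has_vector_derivative F (z t)) (at t within {0..})" by auto
        obtain s where "J s = adjoint B (z t)" using range[OF zt] by auto
        then have "2 * inner (z t) (F (z t)) \<le> 0"
          using energy_decrease[OF zt] dissipation_nonneg by fastforce
        with has_real_derivative_norm_power2[OF dz]
        show "\<exists>d\<le>0. ((\<lambda>t. (norm (z t))\<^sup>2) has_real_derivative d) (at t within {0..})" by blast
      qed
    qed
  qed
  then show ?thesis using init by (simp add: power2_le_iff_abs_le)
qed

text \<open>The graph norm stays bounded along strong solutions, so \<open>D3\<close> bounds the dissipation from below
  by \<open>\<parallel>w z\<parallel>\<^sup>2\<close>. The perturbation \<open>w z - \<sigma>(w z)\<close> itself is measured in \<open>U\<close>, where \<open>D1\<close> controls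
  it by \<open>\<parallel>w z\<parallel>\<close>; hence no regularity of the operator representing \<open>Q\<close> with respect to the graph
  norm is needed.\<close>

lemma semiglobal_exp_stability:
  assumes D1: "D1 J \<sigma>" and D2: "D2 J \<sigma>" and dense: "closure (range J) = UNIV"
    and cS: "cS > 0" "\<And>x. x \<in> D \<Longrightarrow> \<exists>s. J s = adjoint B x \<and> norm s \<le> cS * graph_norm A x"
  shows "semiglobally_exp_stable D A F"
  unfolding semiglobally_exp_stable_def
proof (intro allI impI)
  fix r :: real assume r: "r > 0"
  \<comment> \<open>Solutions starting with norm at most \<open>r\<close> keep that bound, so their
    \<open>w\<close> stays in the ball of radius \<open>b * r\<close>.\<close>
  obtain L where L: "L-lipschitz_on (cball 0 (b * r)) (\<lambda>u. J (\<sigma> u))" using D1 unfolding D1_def by blast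
  have L0: "L \<ge> 0" using L by (rule lipschitz_on_nonneg)
  have \<sigma>_le: "norm (J (\<sigma> (w z))) \<le> L * norm (w z)" if "norm z \<le> r" for z
  proof -
    have "norm (w z) \<le> b * r" using norm_w_le[of z] mult_left_mono[OF that b(1)] by linarith
    then have "dist (J (\<sigma> (w z))) (J (\<sigma> 0)) \<le> L * dist (w z) 0"
      using r b(1) by (intro lipschitz_onD[OF L]) auto
    then show ?thesis by (simp add: damping_0[OF dense])
  qed
  have pert: "norm (sqrt k *\<^sub>R B (J (\<sigma> (w z)))) \<le> b * (L * (b * r))" if "norm z \<le> r" for z
  proof -
    have "norm (J (\<sigma> (w z))) \<le> L * (b * r)"
      using \<sigma>_le[OF that] norm_w_le[of z] mult_left_mono[OF that b(1)] L0
      by (meson mult_left_mono order_trans)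
    then show ?thesis using b by (meson mult_left_mono order_trans)
  qed
  \<comment> \<open>The graph norm bound along trajectories: \<open>r\<close> for the state,
    \<open>r\<close> for \<open>A z0\<close>, and one feedback term each for passing from
    \<open>A z0\<close> to \<open>F z0\<close> and from \<open>F (z t)\<close> back to
    \<open>A (z t)\<close>.\<close>
  define R where "R = 2 * r + 2 * (b * (L * (b * r)))"
  \<comment> \<open>By the bound on \<open>adjoint B\<close>, this dominates the norm in
    \<open>S\<close> of the preimage of \<open>w z\<close>.\<close>
  define \<rho> where "\<rho> = sqrt k * (cS * R)"
  define \<gamma> where "\<gamma> = (1 + C2 * h \<rho> * \<rho>) / C1"
  define G where "G = 4 * (q * b * (1 + L))\<^sup>2 * \<gamma>"
  have R: "R \<ge> 0" using r b(1) L0 by (simp add: R_def)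
  have \<rho>: "\<rho> \<ge> 0" using R k cS(1) by (simp add: \<rho>_def)
  have "\<gamma> \<ge> 0" using \<rho> C1 C2 h_nonneg unfolding \<gamma>_def
    by (intro divide_nonneg_nonneg add_nonneg_nonneg mult_nonneg_nonneg) auto
  then have G0: "G \<ge> 0" by (simp add: G_def)
  \<comment> \<open>Weighting the energy by \<open>M\<close> yields \<open>- G - 2\<close> times the
    dissipation, enough to cancel the error in the derivative of \<open>Q\<close>.\<close>
  define M where "M = 1 + G / 2"
  \<comment> \<open>A quarter of the squared norm equals \<open>\<mu> * (q + M)\<close> times it,
    and \<open>V\<close> is at most \<open>q + M\<close> times the squared norm.\<close>
  define \<mu> where "\<mu> = 1 / (4 * (q + M))"
  have M: "M \<ge> 1" using G0 by (simp add: M_def)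
  have qM: "q + M > 0" using q(1) M by simp
  have \<mu>: "\<mu> > 0" using qM by (simp add: \<mu>_def)
  define V where "V = (\<lambda>x. Q x x + M * (norm x)\<^sup>2)"
  have V_le: "V x \<le> (q + M) * (norm x)\<^sup>2" for x
    using q(2)[of x x] by (simp add: V_def algebra_simps power2_eq_square)
  have V_ge: "(norm x)\<^sup>2 \<le> V x" for x
    using Q(3)[of x] mult_right_mono[OF M, of "(norm x)\<^sup>2"] by (simp add: V_def)
  have decrease: "2 * Q x (F x) + M * (2 * inner x (F x)) \<le> - \<mu> * V x"
    if x: "x \<in> D" and nx: "norm x \<le> r" and gx: "graph_norm A x \<le> R" for x
  proof -
    obtain s where s: "J s = adjoint B x" "norm s \<le> cS * graph_norm A x" using cS(2)[OF x] by blast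
    have "norm s \<le> cS * R" using s(2) mult_left_mono[OF gx, of cS] cS(1) by linarith
    then have s\<rho>: "sqrt k * norm s \<le> \<rho>" using k by (simp add: \<rho>_def)
    have "norm (w x - J (\<sigma> (w x))) \<le> norm (w x) + norm (J (\<sigma> (w x)))" by (rule norm_triangle_ineq4)
    also have "\<dots> \<le> (1 + L) * norm (w x) + 0 * dissipation x"
      using \<sigma>_le[OF nx] by (simp add: algebra_simps)
    finally have "2 * Q x (F x) \<le> - (norm x)\<^sup>2 / 4 + (4 * (q * b * (1 + L))\<^sup>2 * \<gamma> + 2 * q * b * 0 * norm x) * dissipation x"
      by (rule Q_decrease_nonlinear[OF x _ norm_w_power2_le_dissipation[OF s(1) s\<rho>, folded \<gamma>_def]])
    then have 1: "2 * Q x (F x) \<le> - (norm x)\<^sup>2 / 4 + G * dissipation x" by (simp add: G_def)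
    have "M * (2 * inner x (F x)) \<le> M * (2 * (- dissipation x))"
      using energy_decrease[OF x] M by (intro mult_left_mono) auto
    also have "\<dots> = - G * dissipation x - 2 * dissipation x" by (simp add: M_def algebra_simps)
    finally have "2 * Q x (F x) + M * (2 * inner x (F x)) \<le> - (norm x)\<^sup>2 / 4"
      using 1 dissipation_nonneg[OF s(1)] by simp
    also have "\<dots> = - \<mu> * ((q + M) * (norm x)\<^sup>2)" using qM by (simp add: \<mu>_def field_simps)
    also have "\<dots> \<le> - \<mu> * V x" using V_le[of x] \<mu> by simp
    finally show ?thesis .
  qed
  have estimate: "norm (z t) \<le> sqrt (q + M) * exp (- (\<mu> / 2) * t) * norm z0"
    if z0: "z0 \<in> D" "graph_norm A z0 \<le> r" and z: "strong_solution D F z0 z" and t: "t \<ge> 0" for z0 z t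
  proof -
    have lac: "locally_abs_continuous z" and init: "z 0 = z0"
      using z by (auto simp: strong_solution_def)
    have nz0: "norm z0 \<le> r" "norm (A z0) \<le> r"
      using z0(2) norm_ge_zero[of z0] norm_ge_zero[of "A z0"] unfolding graph_norm_def by linarith+
    have nz: "norm (z t) \<le> r" if "t \<ge> 0" for t
    proof -
      have "norm (z t) \<le> norm z0"
        by (rule strong_solution_norm_le[OF z that]) (use cS(2) in \<open>metis rangeI\<close>)
      then show ?thesis using nz0 by simp
    qed
    have speed: "AE t in lebesgue. t \<ge> 0 \<longrightarrow> norm (F (z t)) \<le> norm (F z0)"
      by (rule strong_solution_speed[OF F_monotone[OF D2] z])
    have "V (z t) \<le> exp (- \<mu> * t) * V (z 0)"
    proof (rule AE_deriv_le_imp_exp_decay[OF _ t])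
      show "locally_abs_continuous (\<lambda>t. V (z t))"
        unfolding V_def
      proof (rule locally_abs_continuous_add)
        show "locally_abs_continuous (\<lambda>t. Q (z t) (z t))"
          by (rule locally_abs_continuous_bilinear[OF Q(1) lac lac])
        show "locally_abs_continuous (\<lambda>t. M * (norm (z t))\<^sup>2)"
          by (rule locally_abs_continuous_bilinear[OF bounded_bilinear_mult _
                locally_abs_continuous_norm_power2[OF lac]])
             (auto intro!: locally_abs_continuous_lipschitz exI[of _ 0])
      qed
      show "AE t in lebesgue. t \<ge> 0 \<longrightarrow>
          (\<exists>d\<le>- \<mu> * V (z t). ((\<lambda>t. V (z t)) has_real_derivative d) (at t within {0..}))"
        using strong_solution_derivative[OF z] speed
      proof eventually_elim
        case (elim t)
        show ?case
        proof
          assume t: "t \<ge> 0"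
          with elim have zt: "z t \<in> D" and dz: "(z has_vector_derivative F (z t)) (at t within {0..})"
            and speed: "norm (F (z t)) \<le> norm (F z0)" by auto
          have "norm (F z0) \<le> norm (A z0) + norm (sqrt k *\<^sub>R B (J (\<sigma> (w z0))))"
            unfolding F_eq by (rule norm_triangle_ineq4)
          moreover have "norm (A (z t)) \<le> norm (F (z t)) + norm (sqrt k *\<^sub>R B (J (\<sigma> (w (z t)))))"
            using norm_triangle_ineq[of "F (z t)" "sqrt k *\<^sub>R B (J (\<sigma> (w (z t))))"] unfolding F_eq by simp
          ultimately have "graph_norm A (z t) \<le> R"
            using speed pert[OF nz0(1)] pert[OF nz[OF t]] nz0(2) nz[OF t]
            unfolding graph_norm_def R_def by linarith
          from decrease[OF zt nz[OF t] this]
          have "2 * Q (z t) (F (z t)) + M * (2 * inner (z t) (F (z t))) \<le> - \<mu> * V (z t)" .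
          moreover have "((\<lambda>t. V (z t)) has_real_derivative
              2 * Q (z t) (F (z t)) + M * (2 * inner (z t) (F (z t)))) (at t within {0..})"
            unfolding V_def
            by (intro DERIV_add has_real_derivative_Q[OF dz] DERIV_cmult has_real_derivative_norm_power2[OF dz])
          ultimately show "\<exists>d\<le>- \<mu> * V (z t). ((\<lambda>t. V (z t)) has_real_derivative d) (at t within {0..})"
            by blast
        qed
      qed
    qed
    also have "\<dots> \<le> exp (- \<mu> * t) * ((q + M) * (norm z0)\<^sup>2)"
      using V_le[of z0] init by simp
    \<comment> \<open>\<open>V\<close> is quadratic: taking roots halves the rate and leaves
      \<open>sqrt (q + M)\<close> as the constant.\<close>
    also have "\<dots> = (sqrt (q + M) * exp (- (\<mu> / 2) * t) * norm z0)\<^sup>2"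
      using qM by (simp add: power_mult_distrib exp_double[symmetric])
    finally have "(norm (z t))\<^sup>2 \<le> (sqrt (q + M) * exp (- (\<mu> / 2) * t) * norm z0)\<^sup>2"
      using V_ge[of "z t"] by linarith
    then show ?thesis by (rule power2_le_imp_le) (use qM in simp)
  qed
  show "\<exists>\<mu>>0. \<exists>K>0. \<forall>z0\<in>D. graph_norm A z0 \<le> r \<longrightarrow>
      (\<forall>z. strong_solution D F z0 z \<longrightarrow> (\<forall>t\<ge>0. norm (z t) \<le> K * exp (- \<mu> * t) * norm z0))"
    using \<mu> qM estimate by (intro exI[of _ "\<mu> / 2"] exI[of _ "sqrt (q + M)"] conjI) auto
qed

end

theorem theorem2:
  fixes D :: "'h::{real_inner,complete_space} set"
    and A :: "'h \<Rightarrow> 'h"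
    and B :: "'u::{real_inner,complete_space} \<Rightarrow> 'h"
    and J :: "'s::banach \<Rightarrow> 'u"
    and \<sigma> :: "'u \<Rightarrow> 's"
    and k :: real
  assumes "densely_defined_linear D A"
    and "generates_contractions D A"
    and "bounded_linear B"
    and "k > 0"
    and "generates_exp_stable D (\<lambda>z. A z - k *\<^sub>R B (adjoint B z))"
    and "rigged_hilbert J"
    and "D1 J \<sigma>"
    and "D3 J \<sigma>"
  shows "(trivial_rigging J \<longrightarrow>
            (\<exists>V. strict_global_lyapunov D (A_sigma A B k J \<sigma>) V)) \<and>
         (\<not> trivial_rigging J \<longrightarrow> D2 J \<sigma> \<longrightarrow>
            (\<exists>cS>0. \<forall>x\<in>D. \<exists>s. J s = adjoint B x \<and> norm s \<le> cS * graph_norm A x) \<longrightarrow>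
            semiglobally_exp_stable D A (A_sigma A B k J \<sigma>))"
proof -
  obtain C1 C2 h where D3: "C1 > 0" "C2 > 0" "continuous_on UNIV h" "mono h" "\<And>x. h x \<ge> 0" "h 0 > 0"
    "\<And>s. dual_norm J (J (\<sigma> (J s)) - C1 *\<^sub>R J s) \<le> C2 * h (norm s) * inner (J (\<sigma> (J s))) (J s)"
    using assms(8) unfolding D3_def by blast
  obtain Q :: "'h \<Rightarrow> 'h \<Rightarrow> real" where Q: "bounded_bilinear Q" "\<And>x y. Q x y = Q y x" "\<And>x. 0 \<le> Q x x"
    "\<And>x. x \<in> D \<Longrightarrow> 2 * Q x (A x - k *\<^sub>R B (adjoint B x)) \<le> - (norm x)\<^sup>2 / 2"
    using exp_stable_quadratic_form[OF assms(5)] by blast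
  obtain q where q: "q \<ge> 0" "\<And>x y. norm (Q x y) \<le> norm x * norm y * q"
    using bounded_bilinear.nonneg_bounded[OF Q(1)] by blast
  obtain \<beta> where \<beta>: "\<beta> > 0" "\<And>u. norm (B u) \<le> norm u * \<beta>"
    using bounded_linear.pos_bounded[OF assms(3)] by blast
  have rig: "bounded_linear J" "closure (range J) = UNIV"
    using assms(6) by (auto simp: rigged_hilbert_def)
  \<comment> \<open>The constant \<open>b\<close> of the locale is \<open>sqrt k * \<beta>\<close>,
    where \<beta> bounds \<open>B\<close>.\<close>
  interpret damped_system J \<sigma> C1 C2 h D A B k Q q "sqrt k * \<beta>"
  proof (intro damped_system.intro D3_damping.intro damped_system_axioms.intro)
    show "norm (sqrt k *\<^sub>R B u) \<le> sqrt k * \<beta> * norm u" for u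
      using \<beta>(2)[of u] assms(4) by (simp add: mult_left_mono mult.commute mult.assoc)
    show "\<bar>Q x y\<bar> \<le> q * norm x * norm y" for x y
      using q(2)[of x y] by (simp add: ac_simps)
    show "inner (A x) x \<le> 0" if "x \<in> D" for x
      by (rule generates_contractions_dissipative[OF assms(2) that])
  qed (use assms rig D3 Q q \<beta> in auto)
  show ?thesis
    using lyapunov_trivial_rigging semiglobal_exp_stability[OF assms(7) _ rig(2)] by blast
qed

end
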